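(* Let $(M,w)$ be any Poisson manifold. Then the quantum exterior differential $d_h=d-h\delta$ satisfies $$d_h(\alpha\wedge_h\beta)=(d_h\alpha)\wedge_h\beta+(-1)^{|\alpha|}\alpha\wedge_h(d_h\beta)$$ for all $\alpha,\beta$ in $\Omega(M)[h]$, or $\alpha,\beta$ in $\Omega(M)[h,h^{-1}]$ (with $\alpha$ homogeneous).
   Context: A Poisson manifold $(M,w)$ is a smooth manifold with a bivector field $w$ whose Schouten–Nijenhuis bracket with itself vanishes. In a local frame $\{e_i\}$ of $TM$ with dual frame $\{e^i\}$, $(w^{ij})$ is the skew-symmetric matrix $w^{ij}=w(e^i,e^j)$; repeated indices are summed over all values. For a vector $v$ and a $k$-form $\alpha$, $(v\vdash\alpha)(v_1,\dots,v_{k-1})=\alpha(v,v_1,\dots,v_{k-1})$ and $(\alpha\dashv v)(v_1,\dots,v_{k-1})=\alpha(v_1,\dots,v_{k-1},v)$. The quantum exterior product of forms is $$\alpha\wedge_h\beta=\sum_{n\ge0}\frac{h^n}{n!}w^{i_1j_1}\cdots w^{i_nj_n}(\alpha\dashv e_{i_1}\dashv\cdots\dashv e_{i_n})\wedge(e_{j_n}\vdash\cdots\vdash e_{j_1}\vdash\beta)$$ (contractions with $e_{i_1}$, $e_{j_1}$ are performed first), extended $\mathbb{R}[h]$-bilinearly to $\Omega(M)[h]$ and $\mathbb{R}[h,h^{-1}]$-bilinearly to $\Omega(M)[h,h^{-1}]$. The contraction with $w$ is $w\vdash\alpha=\tfrac12 w^{ij}\,e_i\vdash(e_j\vdash\alpha)$.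 Koszul's operator $\delta:\Omega^k(M)\to\Omega^{k-1}(M)$ is $\delta\alpha=w\vdash d\alpha-d(w\vdash\alpha)$. It satisfies $\delta^2=0$ and $d\delta+\delta d=0$. The quantum exterior differential is $d_h=d-h\delta$, extended linearly over $\mathbb{R}[h]$ (resp. $\mathbb{R}[h,h^{-1}]$). The variable $h$ has degree $2$, forms have their usual degree, and $|\alpha|$ is the degree of a homogeneous element. *)

theory Defs
  imports "HOL-Analysis.Analysis" "HOL-Library.Function_Algebras"
begin

section \<open>Alternating multilinear functions\<close>

text \<open>
  An alternating function of any number of arguments is encoded as a function on lists, its
  restriction to the lists of length k being the component of degree k. One such function
  thus represents an element of the whole exterior algebra. It is used with vectors as arguments
  (forms) and with covectors as arguments (multivectors).
\<close>

definition alternating_multilinear :: "('v::real_vector list \<Rightarrow> real) \<Rightarrow> bool" where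
  "alternating_multilinear f \<longleftrightarrow>
     (\<forall>us vs. linear (\<lambda>v. f (us @ v # vs))) \<and> (\<forall>vs. \<not> distinct vs \<longrightarrow> f vs = 0)"

text \<open>
  Sum over all shuffles: S is the set of positions handed to the first factor, and the sign of
  the shuffle is given by its number of inversions. There is no factorial normalisation, so that
  \<open>wedge f g [u, v] = f [u] * g [v] - f [v] * g [u]\<close> for f and g of degree 1.
\<close>

definition wedge :: "('v list \<Rightarrow> real) \<Rightarrow> ('v list \<Rightarrow> real) \<Rightarrow> 'v list \<Rightarrow> real" where
  "wedge f g vs = (\<Sum>S\<in>Pow {..<length vs}.
     (-1) ^ card {(i, j). i \<in> S \<and> j \<in> {..<length vs} - S \<and> j < i}
       * f (nths vs S) * g (nths vs (- S)))"

definition left_contract :: "'v \<Rightarrow> ('v list \<Rightarrow> real) \<Rightarrow> 'v list \<Rightarrow> real" (infixr \<open>\<turnstile>\<close> 75) where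
  "(v \<turnstile> f) vs = f (v # vs)"

definition right_contract :: "('v list \<Rightarrow> real) \<Rightarrow> 'v \<Rightarrow> 'v list \<Rightarrow> real" (infixl \<open>\<stileturn>\<close> 75) where
  "(f \<stileturn> v) vs = f (vs @ [v])"


section \<open>Smooth manifolds\<close>

text \<open>
  The model space is a real inner product space with a finite orthonormal basis B, that is,
  Euclidean space of dimension \<open>card B\<close>. The class \<open>euclidean_space\<close> is not used because it
  excludes dimension 0.
\<close>

definition orthonormal_basis :: "'e::real_inner set \<Rightarrow> bool" where
  "orthonormal_basis B \<longleftrightarrow>
     finite B \<and> pairwise orthogonal B \<and> (\<forall>b\<in>B. norm b = 1) \<and> span B = UNIV"

fun times_differentiable_on ::
  "nat \<Rightarrow> 'e::real_normed_vector set \<Rightarrow> ('e \<Rightarrow> 'f::real_normed_vector) \<Rightarrow> bool" where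
  "times_differentiable_on 0 S f \<longleftrightarrow> continuous_on S f"
| "times_differentiable_on (Suc k) S f \<longleftrightarrow>
     (\<forall>x\<in>S. f differentiable (at x)) \<and>
     (\<forall>v. times_differentiable_on k S (\<lambda>x. frechet_derivative f (at x) v))"

text \<open>For open subsets S of a finite-dimensional space:\<close>

definition smooth_on :: "'e::real_normed_vector set \<Rightarrow> ('e \<Rightarrow> 'f::real_normed_vector) \<Rightarrow> bool" where
  "smooth_on S f \<longleftrightarrow> (\<forall>k. times_differentiable_on k S f)"

type_synonym ('a, 'e) chart = "'a set \<times> ('a \<Rightarrow> 'e)"

definition image_of :: "('a, 'e) chart \<Rightarrow> 'e set" where
  "image_of c = snd c ` fst c"

definition transition :: "('a, 'e) chart \<Rightarrow> ('a, 'e) chart \<Rightarrow> 'e \<Rightarrow> 'e" where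
  "transition c c' = snd c' \<circ> inv_into (fst c) (snd c)"

definition overlap :: "('a, 'e) chart \<Rightarrow> ('a, 'e) chart \<Rightarrow> 'e set" where
  "overlap c c' = snd c ` (fst c \<inter> fst c')"

definition smooth_atlas :: "'a topology \<Rightarrow> ('a, 'e::real_normed_vector) chart set \<Rightarrow> bool" where
  "smooth_atlas X A \<longleftrightarrow>
     (\<Union>c\<in>A. fst c) = topspace X \<and>
     (\<forall>c\<in>A. openin X (fst c) \<and> open (image_of c) \<and>
        homeomorphic_map (subtopology X (fst c)) (top_of_set (image_of c)) (snd c)) \<and>
     (\<forall>c\<in>A. \<forall>c'\<in>A. smooth_on (overlap c c') (transition c c'))"

definition smooth_manifold ::
  "'e::real_inner set \<Rightarrow> 'a topology \<Rightarrow> ('a, 'e) chart set \<Rightarrow> bool" where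
  "smooth_manifold B X A \<longleftrightarrow>
     orthonormal_basis B \<and> Hausdorff_space X \<and> second_countable X \<and> smooth_atlas X A"


section \<open>Differential forms and multivector fields\<close>

text \<open>
  A form \<open>\<omega>\<close> is given by its representations in the charts of the atlas: \<open>\<omega> c x vs\<close> is the value,
  at the point of the manifold with coordinates x in the chart c, on the tangent vectors with
  components vs in c. The representations are smooth and are related by pullback along the
  transition maps. Likewise for multivector fields, where covectors are pulled back, so
  that the multivectors themselves are pushed forward. Outside the image of a chart, and for charts
  not in the atlas, the value is 0, so that equality of forms is equality of functions.
\<close>

type_synonym ('a, 'e) form = "('a, 'e) chart \<Rightarrow> 'e \<Rightarrow> 'e list \<Rightarrow> real"
type_synonym ('a, 'e) multivector = "('a, 'e) chart \<Rightarrow> 'e \<Rightarrow> ('e \<Rightarrow>\<^sub>L real) list \<Rightarrow> real"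

definition forms :: "('a, 'e::real_normed_vector) chart set \<Rightarrow> ('a, 'e) form set" where
  "forms A = {\<omega>.
     (\<forall>c x. \<not> (c \<in> A \<and> x \<in> image_of c) \<longrightarrow> \<omega> c x = 0) \<and>
     (\<forall>c\<in>A. \<forall>x\<in>image_of c. alternating_multilinear (\<omega> c x)) \<and>
     (\<forall>c\<in>A. \<forall>vs. smooth_on (image_of c) (\<lambda>x. \<omega> c x vs)) \<and>
     (\<forall>c\<in>A. \<forall>c'\<in>A. \<forall>x\<in>overlap c c'. \<forall>vs.
        \<omega> c x vs =
        \<omega> c' (transition c c' x) (map (frechet_derivative (transition c c') (at x)) vs))}"

definition has_degree :: "('a, 'e) form \<Rightarrow> int \<Rightarrow> bool" where
  "has_degree \<omega> k \<longleftrightarrow> (\<forall>c x vs. int (length vs) \<noteq> k \<longrightarrow> \<omega> c x vs = 0)"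

definition multivector_fields ::
  "('a, 'e::real_normed_vector) chart set \<Rightarrow> nat \<Rightarrow> ('a, 'e) multivector set" where
  "multivector_fields A k = {P.
     (\<forall>c x. \<not> (c \<in> A \<and> x \<in> image_of c) \<longrightarrow> P c x = 0) \<and>
     (\<forall>c\<in>A. \<forall>x\<in>image_of c. alternating_multilinear (P c x)) \<and>
     (\<forall>c x \<xi>s. length \<xi>s \<noteq> k \<longrightarrow> P c x \<xi>s = 0) \<and>
     (\<forall>c\<in>A. \<forall>\<xi>s. smooth_on (image_of c) (\<lambda>x. P c x \<xi>s)) \<and>
     (\<forall>c\<in>A. \<forall>c'\<in>A. \<forall>x\<in>overlap c c'. \<forall>\<xi>s.
        P c' (transition c c' x) \<xi>s =
        P c x (map (\<lambda>\<xi>. \<xi> o\<^sub>L Blinfun (frechet_derivative (transition c c') (at x))) \<xi>s))}"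

text \<open>
  On constant vector fields of a chart all Lie brackets vanish, so only the derivative terms of the
  invariant formula for the exterior derivative remain.
\<close>

definition ext_d :: "('a, 'e::real_normed_vector) form \<Rightarrow> ('a, 'e) form" where
  "ext_d \<omega> c x vs =
     (if x \<in> image_of c
      then \<Sum>i<length vs. (-1) ^ i *
             frechet_derivative (\<lambda>y. \<omega> c y (take i vs @ drop (Suc i) vs)) (at x) (vs ! i)
      else 0)"


section \<open>Poisson manifolds\<close>

text \<open>
  The local frame of a chart is the coordinate frame, whose vectors have the elements of B as
  components, with dual frame \<open>coframe b\<close> for b in B. The sums over frame indices below are
  contractions of a vector index with a covector index, so any other frame gives the same values.
\<close>

abbreviation coframe :: "'e::real_inner \<Rightarrow> 'e \<Rightarrow>\<^sub>L real" where
  "coframe b \<equiv> blinfun_inner_left b"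

text \<open>
  The Schouten--Nijenhuis bracket of a multivector field P of degree p and Q of degree q. In
  coordinates,
  \<open>[P, Q] = (\<Sum>i. (P \<stileturn> e\<^sup>i) \<and> \<partial>\<^sub>i Q) - (-1)^((p-1)(q-1)) (\<Sum>i. (Q \<stileturn> e\<^sup>i) \<and> \<partial>\<^sub>i P)\<close>;
  this is the Lie bracket for p = q = 1 and the derivative \<open>P f\<close> for p = 1 and a function
  Q = f. The exponent is written with p + 1 and q + 1, which have the same parity, because
  subtraction on nat truncates.
\<close>

definition partial_multivector :: "'e::real_normed_vector \<Rightarrow> ('a, 'e) multivector \<Rightarrow> ('a, 'e) multivector"
  where
  "partial_multivector v P c x \<xi>s = frechet_derivative (\<lambda>y. P c y \<xi>s) (at x) v"

definition schouten ::
  "'e::real_inner set \<Rightarrow> nat \<Rightarrow> nat \<Rightarrow> ('a, 'e) multivector \<Rightarrow> ('a, 'e) multivector \<Rightarrow> ('a, 'e) multivector"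
  where
  "schouten B p q P Q c x \<xi>s =
     (if x \<in> image_of c
      then (\<Sum>b\<in>B. wedge (P c x \<stileturn> coframe b) (partial_multivector b Q c x) \<xi>s)
         - (-1) ^ ((p + 1) * (q + 1)) *
           (\<Sum>b\<in>B. wedge (Q c x \<stileturn> coframe b) (partial_multivector b P c x) \<xi>s)
      else 0)"

definition poisson_manifold ::
  "'e::real_inner set \<Rightarrow> 'a topology \<Rightarrow> ('a, 'e) chart set \<Rightarrow> ('a, 'e) multivector \<Rightarrow> bool" where
  "poisson_manifold B X A w \<longleftrightarrow>
     smooth_manifold B X A \<and> w \<in> multivector_fields A 2 \<and> schouten B 2 2 w w = 0"

definition w_contract :: "'e::real_inner set \<Rightarrow> ('a, 'e) multivector \<Rightarrow> ('a, 'e) form \<Rightarrow> ('a, 'e) form"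
  where
  "w_contract B w \<alpha> c x vs =
     1 / 2 * (\<Sum>i\<in>B. \<Sum>j\<in>B. w c x [coframe i, coframe j] * (i \<turnstile> (j \<turnstile> \<alpha> c x)) vs)"

definition koszul :: "'e::real_inner set \<Rightarrow> ('a, 'e) multivector \<Rightarrow> ('a, 'e) form \<Rightarrow> ('a, 'e) form"
  where
  "koszul B w \<alpha> = w_contract B w (ext_d \<alpha>) - ext_d (w_contract B w \<alpha>)"


section \<open>The quantum exterior algebra\<close>

text \<open>
  The coefficient of \<open>h^n\<close> in the quantum exterior product of two forms; is and js are the index
  tuples, and \<open>foldl\<close> performs the contractions with their first entries first.
\<close>

definition quantum_term ::
  "'e::real_inner set \<Rightarrow> ('a, 'e) multivector \<Rightarrow> nat \<Rightarrow> ('a, 'e) form \<Rightarrow> ('a, 'e) form \<Rightarrow> ('a, 'e) form"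
  where
  "quantum_term B w n \<alpha> \<beta> c x vs =
     1 / fact n *
     (\<Sum>is\<in>{is. set is \<subseteq> B \<and> length is = n}. \<Sum>js\<in>{js. set js \<subseteq> B \<and> length js = n}.
        (\<Prod>k<n. w c x [coframe (is ! k), coframe (js ! k)]) *
        wedge (foldl (\<lambda>f i. f \<stileturn> i) (\<alpha> c x) is) (foldl (\<lambda>f j. j \<turnstile> f) (\<beta> c x) js) vs)"

text \<open>
  A Laurent polynomial in h with forms as coefficients is the function mapping n to the
  coefficient of \<open>h^n\<close>.
\<close>

type_synonym ('a, 'e) hform = "int \<Rightarrow> ('a, 'e) form"

definition h_support :: "('a, 'e) hform \<Rightarrow> int set" where
  "h_support \<alpha> = {n. \<alpha> n \<noteq> 0}"

definition laurent_forms :: "('a, 'e::real_normed_vector) chart set \<Rightarrow> ('a, 'e) hform set" where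
  "laurent_forms A = {\<alpha>. finite (h_support \<alpha>) \<and> (\<forall>n. \<alpha> n \<in> forms A)}"

definition poly_forms :: "('a, 'e::real_normed_vector) chart set \<Rightarrow> ('a, 'e) hform set" where
  "poly_forms A = {\<alpha> \<in> laurent_forms A. \<forall>n<0. \<alpha> n = 0}"

text \<open>Here h has degree 2.\<close>

definition homogeneous :: "('a, 'e) hform \<Rightarrow> int \<Rightarrow> bool" where
  "homogeneous \<alpha> k \<longleftrightarrow> (\<forall>n. has_degree (\<alpha> n) (k - 2 * n))"

definition h_scale :: "real \<Rightarrow> ('a, 'e) hform \<Rightarrow> ('a, 'e) hform" where
  "h_scale r \<alpha> n c x vs = r * \<alpha> n c x vs"

text \<open>
  The coefficient of \<open>h^m\<close> collects the products of \<open>h^a\<close>, \<open>h^b\<close> and \<open>h^n\<close> with \<open>a + b + n = m\<close>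
  and \<open>n \<ge> 0\<close>.
\<close>

definition quantum_wedge ::
  "'e::real_inner set \<Rightarrow> ('a, 'e) multivector \<Rightarrow> ('a, 'e) hform \<Rightarrow> ('a, 'e) hform \<Rightarrow> ('a, 'e) hform"
  where
  "quantum_wedge B w \<alpha> \<beta> m =
     (\<Sum>a\<in>h_support \<alpha>. \<Sum>b\<in>h_support \<beta>.
        if a + b \<le> m then quantum_term B w (nat (m - a - b)) (\<alpha> a) (\<beta> b) else 0)"

definition quantum_d :: "'e::real_inner set \<Rightarrow> ('a, 'e) multivector \<Rightarrow> ('a, 'e) hform \<Rightarrow> ('a, 'e) hform"
  where
  "quantum_d B w \<alpha> m = ext_d (\<alpha> m) - koszul B w (\<alpha> (m - 1))"

end

theory Submission
  imports Defs
begin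

text \<open>
  Write \<open>W\<close> for the contraction with w. The wedge product fails to commute with \<open>W\<close> exactly by the
  coefficient of h in the quantum product, which gives
  \<open>\<alpha> \<and>\<^sub>h \<beta> = exp (- h W) (exp (h W) \<alpha> \<and> exp (h W) \<beta>)\<close>. Since \<open>\<delta> = [W, d]\<close>, and \<open>[W, \<delta>] = 0\<close> by the
  Jacobi identity, \<open>d\<^sub>h = exp (- h W) d exp (h W)\<close>. So the Leibniz rule for d is conjugated into the one
  for \<open>d\<^sub>h\<close>. The exponentials are avoided by comparing coefficients: the unnormalised coefficient
  \<open>C\<^sub>n\<close> of \<open>h^n\<close> satisfies \<open>C\<^sub>n\<^sub>+\<^sub>1 (\<alpha>, \<beta>) = C\<^sub>n (W \<alpha>, \<beta>) + C\<^sub>n (\<alpha>, W \<beta>) - W (C\<^sub>n (\<alpha>, \<beta>))\<close>, and the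
  Leibniz rule follows by induction on n. Everything takes place in a single chart, where only the
  alternating property and differentiability of the coefficients are used.
\<close>

section \<open>Skew functions of lists and their wedge product\<close>

text \<open>The recursion through W is what keeps derivatives of w under control. Applying d to the
  defining sum of C_n would differentiate every coefficient w^{ij}, and the contractions with frame
  vectors are odd, so signs would pile up. W is one even operator; it commutes with
  \<open>grade\<close> and, on skew forms, with contractions. Through it all derivatives of w are
  absorbed into \<delta>, and they are met only in the proof of [W, \<delta>] = 0. Written out, that
  identity is W W d - 2 W d W + d W W = 0: every term contains a single d, as in the Leibniz rule,
  so differentiability of first order is carried along. The sign (-1)^{|\<alpha>|} is represented by
  the operator \<open>grade\<close>, which makes sense for inhomogeneous forms; it becomes a scalar
  only at the very end. Identities that involve d are checked by induction on the argument list: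
  contracting both sides with its first vector leads to the same identity for contracted forms,
  which is why the forms are always kept arbitrary.\<close>

definition skew :: "('v list \<Rightarrow> real) \<Rightarrow> bool" where
  "skew f \<longleftrightarrow> (\<forall>us a b vs. f (us @ a # b # vs) = - f (us @ b # a # vs))"

text \<open>The grading automorphism. The length of the argument list is the degree of the
  component, so it is defined on inhomogeneous elements.\<close>

definition invol :: "('v list \<Rightarrow> real) \<Rightarrow> 'v list \<Rightarrow> real" where
  "invol f vs = (-1) ^ length vs * f vs"

lemma skewI: "(\<And>us a b vs. f (us @ a # b # vs) = - f (us @ b # a # vs)) \<Longrightarrow> skew f"
  unfolding skew_def by blast

lemma skewD: "skew f \<Longrightarrow> f (us @ a # b # vs) = - f (us @ b # a # vs)"
  unfolding skew_def by blast

lemma skew_Cons: "skew f \<Longrightarrow> f (a # b # vs) = - f (b # a # vs)"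
  using skewD[of f "[]" a b vs] by simp

text \<open>Polarisation: inserting a + b in two neighbouring places gives 0, and of the four terms
  of the expansion the two with a repeated argument vanish as well.\<close>

lemma alternating_multilinear_skew:
  assumes "alternating_multilinear f"
  shows "skew f"
  unfolding skew_def
proof (intro allI)
  fix us a b vs
  have lin: "linear (\<lambda>v. f (us' @ v # vs'))" for us' vs'
    using assms unfolding alternating_multilinear_def by blast
  have rep: "f (us @ v # v # vs) = 0" for v
  proof -
    have "\<not> distinct (us @ v # v # vs)" by simp
    then show ?thesis using assms unfolding alternating_multilinear_def by blast
  qed
  have add1: "f (us @ (u + v) # ws) = f (us @ u # ws) + f (us @ v # ws)" for u v ws
    using linear_add[OF lin] .
  have add2: "f (us @ c # (u + v) # vs) = f (us @ c # u # vs) + f (us @ c # v # vs)" for c u v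
    using linear_add[OF lin[of "us @ [c]" vs]] unfolding append_assoc append_Cons append_Nil .
  have "0 = f (us @ (a + b) # (a + b) # vs)"
    by (simp add: rep)
  also have "\<dots> = f (us @ a # b # vs) + f (us @ b # a # vs)"
    using rep[of a] rep[of b] by (simp add: add1 add2)
  finally show "f (us @ a # b # vs) = - f (us @ b # a # vs)"
    by linarith
qed

lemma skew_snoc:
  assumes "skew f"
  shows "f (vs @ [v]) = (-1) ^ length vs * f (v # vs)"
proof -
  \<comment> \<open>The prefix is needed because the induction strips entries from the front while v
    moves in from the end.\<close>
  have "f (us @ vs @ [v]) = (-1) ^ length vs * f (us @ v # vs)" for us
  proof (induction vs arbitrary: us)
    case (Cons u vs)
    show ?case
      using Cons[of "us @ [u]"] skewD[OF assms, of us u v vs] by simp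
  qed simp
  from this[of "[]"] show ?thesis by simp
qed

text \<open>The contracted vector travels past all remaining arguments, which yields the degree sign
  of the contracted form.\<close>

lemma skew_right_contract:
  "skew f \<Longrightarrow> f \<stileturn> v = invol (v \<turnstile> f)"
  by (rule ext) (simp add: right_contract_def left_contract_def invol_def skew_snoc)

lemma wedge_Nil [simp]: "wedge f g [] = f [] * g []"
  by (simp add: wedge_def)

text \<open>Contraction is an antiderivation. The shuffles are split according to the factor that
  receives position 0. If it is the first one, no inversion is added; if it is the second one,
  position 0 is inverted with every position of the first factor, and these number the degree of f,
  whence \<open>invol f\<close>.\<close>

lemma wedge_Cons: "wedge f g (v # vs) = wedge (v \<turnstile> f) g vs + wedge (invol f) (v \<turnstile> g) vs"
proof -
  let ?n = "length vs"
  define inv where "inv n S = {(i, j). i \<in> S \<and> j \<in> {..<n} - S \<and> j < i}" for n :: nat and S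
  let ?g = "\<lambda>S. (-1) ^ card (inv (Suc ?n) S) * f (nths (v # vs) S) * g (nths (v # vs) (- S))"
  have Pow_eq: "Pow {..<Suc ?n} =
      (\<lambda>S. insert 0 (Suc ` S)) ` Pow {..<?n} \<union> (image Suc) ` Pow {..<?n}"
  proof (intro set_eqI iffI)
    fix S assume S: "S \<in> Pow {..<Suc ?n}"
    define S' where "S' = {i. Suc i \<in> S}"
    have S': "S' \<in> Pow {..<?n}" using S by (auto simp: S'_def)
    have "S - {0} = Suc ` S'"
    proof (rule set_eqI)
      fix i show "i \<in> S - {0} \<longleftrightarrow> i \<in> Suc ` S'"
        by (cases i) (auto simp: S'_def)
    qed
    then have "S = insert 0 (Suc ` S') \<or> S = Suc ` S'" by auto
    then show "S \<in> (\<lambda>S. insert 0 (Suc ` S)) ` Pow {..<?n} \<union> (image Suc) ` Pow {..<?n}"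
      using S' by blast
  qed (auto simp: less_Suc_eq_0_disj)
  have inj: "inj (\<lambda>S. insert 0 (Suc ` S))" "inj (image Suc)"
    by (auto simp: inj_def set_eq_iff image_iff)
  have fin: "finite (inv ?n S)" if "S \<in> Pow {..<?n}" for S
    by (rule finite_subset[of _ "{..<?n} \<times> {..<?n}"]) (use that in \<open>auto simp: inv_def\<close>)
  have inv0: "inv (Suc ?n) (insert 0 (Suc ` S)) = map_prod Suc Suc ` inv ?n S" for S
  proof (intro set_eqI iffI)
    fix p assume "p \<in> inv (Suc ?n) (insert 0 (Suc ` S))"
    then obtain i j where p: "p = (i, j)" "i \<in> insert 0 (Suc ` S)"
      "j \<in> {..<Suc ?n} - insert 0 (Suc ` S)" "j < i" by (auto simp: inv_def)
    then show "p \<in> map_prod Suc Suc ` inv ?n S"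
      by (cases i; cases j) (auto simp: inv_def image_iff)
  qed (auto simp: inv_def)
  \<comment> \<open>The pairs (i, 0) in the second set are the new inversions, one for each element
    of S.\<close>
  have inv1: "inv (Suc ?n) (Suc ` S) = map_prod Suc Suc ` inv ?n S \<union> (\<lambda>i. (Suc i, 0)) ` S" for S
  proof (intro set_eqI iffI)
    fix p assume "p \<in> inv (Suc ?n) (Suc ` S)"
    then obtain i j where p: "p = (Suc i, j)" "i \<in> S"
      "j \<in> {..<Suc ?n} - Suc ` S" "j < Suc i" by (auto simp: inv_def)
    then show "p \<in> map_prod Suc Suc ` inv ?n S \<union> (\<lambda>i. (Suc i, 0)) ` S"
      by (cases j) (auto simp: inv_def image_iff)
  qed (auto simp: inv_def)
  have card_pair: "card (map_prod Suc Suc ` X) = card X" for X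
    by (rule card_image) (auto simp: inj_on_def)
  have card0: "card (inv (Suc ?n) (insert 0 (Suc ` S))) = card (inv ?n S)" for S
    by (simp add: inv0 card_pair)
  have card1: "card (inv (Suc ?n) (Suc ` S)) = card (inv ?n S) + card S"
    if "S \<in> Pow {..<?n}" for S
  proof -
    have "finite S" using that finite_subset by auto
    then have "card (inv (Suc ?n) (Suc ` S)) =
        card (map_prod Suc Suc ` inv ?n S) + card ((\<lambda>i. (Suc i, 0::nat)) ` S)"
      unfolding inv1 using fin[OF that] by (intro card_Un_disjoint) auto
    also have "\<dots> = card (inv ?n S) + card S"
      by (simp add: card_pair card_image inj_on_def)
    finally show ?thesis .
  qed
  have len: "length (nths vs S) = card S" if "S \<in> Pow {..<?n}" for S
    unfolding length_nths using that by (intro arg_cong[where f=card]) auto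
  have wedge_eq: "wedge f' g' us = (\<Sum>S\<in>Pow {..<length us}.
      (-1) ^ card (inv (length us) S) * f' (nths us S) * g' (nths us (- S)))" for f' g' us
    unfolding wedge_def inv_def ..
  have Suc_vimage: "{j. Suc j \<in> insert 0 (Suc ` S)} = S" "{j. Suc j \<in> Suc ` S} = S"
    "{j. Suc j \<in> - insert 0 (Suc ` S)} = - S" "{j. Suc j \<in> - Suc ` S} = - S" for S
    by auto
  have "wedge f g (v # vs) = (\<Sum>S\<in>Pow {..<Suc ?n}. ?g S)"
    by (simp only: wedge_eq length_Cons)
  also have "\<dots> = (\<Sum>S\<in>(\<lambda>S. insert 0 (Suc ` S)) ` Pow {..<?n}. ?g S)
      + (\<Sum>S\<in>(image Suc) ` Pow {..<?n}. ?g S)"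
    unfolding Pow_eq by (intro sum.union_disjoint) auto
  also have "(\<Sum>S\<in>(\<lambda>S. insert 0 (Suc ` S)) ` Pow {..<?n}. ?g S) =
      (\<Sum>S\<in>Pow {..<?n}. ?g (insert 0 (Suc ` S)))"
    by (subst sum.reindex[OF inj_on_subset[OF inj(1) subset_UNIV]]) (simp only: comp_def)
  also have "\<dots> = wedge (v \<turnstile> f) g vs"
    unfolding wedge_eq nths_Cons Suc_vimage card0 by (simp add: left_contract_def)
  also have "(\<Sum>S\<in>(image Suc) ` Pow {..<?n}. ?g S) = (\<Sum>S\<in>Pow {..<?n}. ?g (Suc ` S))"
    by (subst sum.reindex[OF inj_on_subset[OF inj(2) subset_UNIV]]) (simp only: comp_def)
  also have "\<dots> = wedge (invol f) (v \<turnstile> g) vs"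
    unfolding wedge_eq nths_Cons Suc_vimage
  proof (rule sum.cong[OF refl])
    fix S assume S: "S \<in> Pow {..<?n}"
    show "(-1) ^ card (inv (Suc ?n) (Suc ` S)) * f ((if 0 \<in> Suc ` S then [v] else []) @ nths vs S)
        * g ((if 0 \<in> - Suc ` S then [v] else []) @ nths vs (- S))
      = (-1) ^ card (inv ?n S) * invol f (nths vs S) * (v \<turnstile> g) (nths vs (- S))"
      unfolding card1[OF S] invol_def len[OF S]
      by (simp add: left_contract_def power_add)
  qed
  finally show ?thesis .
qed

lemma wedge_add_left: "wedge (f + f') g vs = wedge f g vs + wedge f' g vs"
  by (simp add: wedge_def algebra_simps sum.distrib)

lemma wedge_add_right: "wedge f (g + g') vs = wedge f g vs + wedge f g' vs"
  by (simp add: wedge_def algebra_simps sum.distrib)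

lemma wedge_scale_left: "wedge (\<lambda>us. r * f us) g vs = r * wedge f g vs"
  by (simp add: wedge_def sum_distrib_left mult_ac)

lemma wedge_scale_right: "wedge f (\<lambda>us. r * g us) vs = r * wedge f g vs"
  by (simp add: wedge_def sum_distrib_left mult_ac)

lemma wedge_minus_left: "wedge (\<lambda>us. - f us) g vs = - wedge f g vs"
  using wedge_scale_left[of "-1" f g] by simp

lemma wedge_minus_right: "wedge f (\<lambda>us. - g us) vs = - wedge f g vs"
  using wedge_scale_right[of f "-1" g] by simp

lemma wedge_sum_left: "wedge (\<lambda>us. \<Sum>i\<in>I. F i us) g vs = (\<Sum>i\<in>I. wedge (F i) g vs)"
  unfolding wedge_def sum_distrib_left sum_distrib_right by (subst sum.swap) (rule refl)

lemma wedge_sum_right: "wedge f (\<lambda>us. \<Sum>i\<in>I. G i us) vs = (\<Sum>i\<in>I. wedge f (G i) vs)"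
  unfolding wedge_def sum_distrib_left sum_distrib_right by (subst sum.swap) (rule refl)

lemma left_contract_invol: "v \<turnstile> invol f = (\<lambda>us. - invol (v \<turnstile> f) us)"
  by (rule ext) (simp add: left_contract_def invol_def)

lemma invol_invol [simp]: "invol (invol f) = f"
  by (rule ext) (simp add: invol_def)

text \<open>The minus sign arises because contraction anticommutes with \<open>invol\<close>. The
  two mixed terms are the source of the quantum correction.\<close>

lemma wedge_Cons2:
  "wedge f g (a # b # vs) =
     wedge (b \<turnstile> (a \<turnstile> f)) g vs + wedge (invol (a \<turnstile> f)) (b \<turnstile> g) vs
     - wedge (invol (b \<turnstile> f)) (a \<turnstile> g) vs + wedge f (b \<turnstile> (a \<turnstile> g)) vs"
  by (simp add: wedge_Cons left_contract_invol wedge_minus_left)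

lemma skew_left_contract [intro]: "skew f \<Longrightarrow> skew (v \<turnstile> f)"
  unfolding skew_def left_contract_def by (metis append_Cons)

lemma skew_contract_right [intro]: "skew f \<Longrightarrow> skew (f \<stileturn> v)"
  unfolding skew_def right_contract_def append_assoc append_Cons by blast

lemma skew_invol [intro]: "skew f \<Longrightarrow> skew (invol f)"
proof (rule skewI)
  fix us a b vs assume "skew f"
  from skewD[OF this, of us a b vs] show "invol f (us @ a # b # vs) = - invol f (us @ b # a # vs)"
    by (simp add: invol_def)
qed

lemma left_contract_left_contract:
  "skew f \<Longrightarrow> a \<turnstile> (b \<turnstile> f) = (\<lambda>us. - (b \<turnstile> (a \<turnstile> f)) us)"
  unfolding left_contract_def by (rule ext) (rule skew_Cons)

text \<open>Contracting along the prefix leaves the case where a and b come first. There the outer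
  terms of \<open>wedge_Cons2\<close> change sign by skewness of f and g, and the mixed ones trade
  places.\<close>

lemma skew_wedge [intro]:
  assumes "skew f" "skew g"
  shows "skew (wedge f g)"
  unfolding skew_def
proof (intro allI)
  fix us a b vs
  show "wedge f g (us @ a # b # vs) = - wedge f g (us @ b # a # vs)"
    using assms
  proof (induction us arbitrary: f g)
    case Nil
    have "wedge (b \<turnstile> (a \<turnstile> f)) g vs = - wedge (a \<turnstile> (b \<turnstile> f)) g vs"
      "wedge f (b \<turnstile> (a \<turnstile> g)) vs = - wedge f (a \<turnstile> (b \<turnstile> g)) vs"
      unfolding left_contract_left_contract[OF Nil(1), of b a]
        left_contract_left_contract[OF Nil(2), of b a] wedge_minus_left wedge_minus_right
      by (rule refl)+
    then show ?case by (simp add: wedge_Cons2)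
  next
    case (Cons u us)
    have "wedge (u \<turnstile> f) g (us @ a # b # vs) = - wedge (u \<turnstile> f) g (us @ b # a # vs)"
      "wedge (invol f) (u \<turnstile> g) (us @ a # b # vs) = - wedge (invol f) (u \<turnstile> g) (us @ b # a # vs)"
      by (intro Cons.IH skew_left_contract skew_invol Cons.prems)+
    then show ?case by (simp add: wedge_Cons)
  qed
qed

section \<open>Differentiation of forms\<close>

lemma frechet_derivative_real_add:
  fixes f g :: "'e::real_normed_vector \<Rightarrow> real"
  assumes "f differentiable (at x)" "g differentiable (at x)"
  shows "frechet_derivative (\<lambda>y. f y + g y) (at x) v =
    frechet_derivative f (at x) v + frechet_derivative g (at x) v"
  by (subst frechet_derivative_at[symmetric],
      rule has_derivative_add[OF assms[unfolded frechet_derivative_works]]) (rule refl)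

lemma frechet_derivative_real_mult:
  fixes f g :: "'e::real_normed_vector \<Rightarrow> real"
  assumes "f differentiable (at x)" "g differentiable (at x)"
  shows "frechet_derivative (\<lambda>y. f y * g y) (at x) v =
    f x * frechet_derivative g (at x) v + frechet_derivative f (at x) v * g x"
  by (subst frechet_derivative_at[symmetric],
      rule has_derivative_mult[OF assms[unfolded frechet_derivative_works]]) (rule refl)

lemma frechet_derivative_real_cmult:
  fixes f :: "'e::real_normed_vector \<Rightarrow> real"
  assumes "f differentiable (at x)"
  shows "frechet_derivative (\<lambda>y. r * f y) (at x) v = r * frechet_derivative f (at x) v"
  using frechet_derivative_real_mult[of "\<lambda>y. r" x f v] assms by simp

lemma frechet_derivative_real_sum:
  fixes f :: "'i \<Rightarrow> 'e::real_normed_vector \<Rightarrow> real"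
  assumes "\<And>i. i \<in> I \<Longrightarrow> f i differentiable (at x)"
  shows "frechet_derivative (\<lambda>y. \<Sum>i\<in>I. f i y) (at x) v =
    (\<Sum>i\<in>I. frechet_derivative (f i) (at x) v)"
proof -
  have "((\<lambda>y. \<Sum>i\<in>I. f i y) has_derivative
      (\<lambda>v. \<Sum>i\<in>I. frechet_derivative (f i) (at x) v)) (at x)"
    by (rule has_derivative_sum) (use assms frechet_derivative_works in blast)
  from frechet_derivative_at[OF this] show ?thesis
    by metis
qed

text \<open>The quantifier ranges over all pairs of the chart type: members of \<open>forms\<close>
  are 0 off the atlas, so no atlas has to be carried along.\<close>

definition differentiable_form :: "('a, 'e::real_normed_vector) form \<Rightarrow> bool" where
  "differentiable_form \<alpha> \<longleftrightarrow>
     (\<forall>c x vs. x \<in> image_of c \<longrightarrow> (\<lambda>y. \<alpha> c y vs) differentiable (at x))"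

definition skew_form :: "('a, 'e) form \<Rightarrow> bool" where
  "skew_form \<alpha> \<longleftrightarrow> (\<forall>c x. skew (\<alpha> c x))"

definition interior_form :: "'e \<Rightarrow> ('a, 'e) form \<Rightarrow> ('a, 'e) form" where
  "interior_form v \<alpha> c x = v \<turnstile> \<alpha> c x"

definition grade :: "('a, 'e) form \<Rightarrow> ('a, 'e) form" where
  "grade \<alpha> c x = invol (\<alpha> c x)"

definition wedge_form :: "('a, 'e) form \<Rightarrow> ('a, 'e) form \<Rightarrow> ('a, 'e) form" where
  "wedge_form \<alpha> \<beta> c x = wedge (\<alpha> c x) (\<beta> c x)"

definition scale_form :: "real \<Rightarrow> ('a, 'e) form \<Rightarrow> ('a, 'e) form" where
  "scale_form r \<alpha> c x vs = r * \<alpha> c x vs"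

text \<open>The Lie derivative along the constant field v of the chart. The value 0 outside the
  image matches \<open>ext_d\<close>, so that Cartan's formula is an equation of functions.\<close>

definition partial_form :: "'e::real_normed_vector \<Rightarrow> ('a, 'e) form \<Rightarrow> ('a, 'e) form" where
  "partial_form v \<alpha> c x vs =
     (if x \<in> image_of c then frechet_derivative (\<lambda>y. \<alpha> c y vs) (at x) v else 0)"

lemma form_ext: "(\<And>c x vs. \<alpha> c x vs = \<beta> c x vs) \<Longrightarrow> \<alpha> = (\<beta> :: ('a, 'e) form)"
  by (intro ext)

lemma interior_apply [simp]: "interior_form v \<alpha> c x vs = \<alpha> c x (v # vs)"
  by (simp add: interior_form_def left_contract_def)

lemma grade_apply: "grade \<alpha> c x vs = (-1) ^ length vs * \<alpha> c x vs"
  by (simp add: grade_def invol_def)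

lemma differentiable_formD:
  "differentiable_form \<alpha> \<Longrightarrow> x \<in> image_of c \<Longrightarrow> (\<lambda>y. \<alpha> c y vs) differentiable (at x)"
  unfolding differentiable_form_def by blast

lemma differentiable_form_add [intro]:
  "differentiable_form \<alpha> \<Longrightarrow> differentiable_form \<beta> \<Longrightarrow> differentiable_form (\<alpha> + \<beta>)"
  unfolding differentiable_form_def by simp

lemma differentiable_form_diff [intro]:
  "differentiable_form \<alpha> \<Longrightarrow> differentiable_form \<beta> \<Longrightarrow> differentiable_form (\<alpha> - \<beta>)"
  unfolding differentiable_form_def by simp

lemma differentiable_form_scale [intro]:
  "differentiable_form \<alpha> \<Longrightarrow> differentiable_form (scale_form r \<alpha>)"
  unfolding differentiable_form_def scale_form_def by simp

lemma differentiable_form_interior [intro]: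
  "differentiable_form \<alpha> \<Longrightarrow> differentiable_form (interior_form v \<alpha>)"
  unfolding differentiable_form_def by simp

lemma differentiable_form_grade [intro]:
  "differentiable_form \<alpha> \<Longrightarrow> differentiable_form (grade \<alpha>)"
  unfolding differentiable_form_def grade_def invol_def by simp

lemma differentiable_form_wedge [intro]:
  "differentiable_form \<alpha> \<Longrightarrow> differentiable_form \<beta> \<Longrightarrow> differentiable_form (wedge_form \<alpha> \<beta>)"
  unfolding differentiable_form_def wedge_form_def wedge_def
  by (auto intro!: differentiable_sum differentiable_mult)

lemma skew_formD: "skew_form \<alpha> \<Longrightarrow> skew (\<alpha> c x)"
  unfolding skew_form_def by blast

lemma skew_form_interior [intro]: "skew_form \<alpha> \<Longrightarrow> skew_form (interior_form v \<alpha>)"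
  unfolding skew_form_def interior_form_def by blast

lemma skew_form_grade [intro]: "skew_form \<alpha> \<Longrightarrow> skew_form (grade \<alpha>)"
  unfolding skew_form_def grade_def by blast

lemma skew_form_wedge [intro]: "skew_form \<alpha> \<Longrightarrow> skew_form \<beta> \<Longrightarrow> skew_form (wedge_form \<alpha> \<beta>)"
  unfolding skew_form_def wedge_form_def by blast

lemma skew_diff:
  assumes "skew f" "skew g"
  shows "skew (f - g)"
proof (rule skewI)
  fix us a b vs
  show "(f - g) (us @ a # b # vs) = - (f - g) (us @ b # a # vs)"
    using skewD[OF assms(1), of us a b vs] skewD[OF assms(2), of us a b vs] by simp
qed

lemma skew_form_diff [intro]: "skew_form \<alpha> \<Longrightarrow> skew_form \<beta> \<Longrightarrow> skew_form (\<alpha> - \<beta>)"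
  unfolding skew_form_def by (auto intro: skew_diff)

lemma interior_swap:
  assumes "skew_form \<alpha>"
  shows "interior_form a (interior_form b \<alpha>) = - interior_form b (interior_form a \<alpha>)"
proof (rule form_ext)
  fix c x vs
  show "interior_form a (interior_form b \<alpha>) c x vs = (- interior_form b (interior_form a \<alpha>)) c x vs"
    using skew_Cons[OF skew_formD[OF assms], of c x b a vs] by simp
qed

lemma interior_add: "interior_form v (\<alpha> + \<beta>) = interior_form v \<alpha> + interior_form v \<beta>"
  by (intro form_ext) simp

lemma interior_diff: "interior_form v (\<alpha> - \<beta>) = interior_form v \<alpha> - interior_form v \<beta>"
  by (intro form_ext) simp

lemma interior_grade: "interior_form v (grade \<alpha>) = - grade (interior_form v \<alpha>)"
  by (intro form_ext) (simp add: grade_def invol_def)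

lemma interior_wedge:
  "interior_form v (wedge_form \<alpha> \<beta>) =
     wedge_form (interior_form v \<alpha>) \<beta> + wedge_form (grade \<alpha>) (interior_form v \<beta>)"
  by (intro form_ext)
    (simp add: wedge_form_def wedge_Cons grade_def interior_form_def left_contract_def[of _ "wedge _ _"])

lemma grade_grade [simp]: "grade (grade \<alpha>) = \<alpha>"
  by (intro form_ext) (simp add: grade_def)

lemma wedge_form_add_left: "wedge_form (\<alpha> + \<alpha>') \<beta> = wedge_form \<alpha> \<beta> + wedge_form \<alpha>' \<beta>"
  by (intro form_ext) (simp add: wedge_form_def wedge_add_left)

lemma wedge_form_add_right: "wedge_form \<alpha> (\<beta> + \<beta>') = wedge_form \<alpha> \<beta> + wedge_form \<alpha> \<beta>'"
  by (intro form_ext) (simp add: wedge_form_def wedge_add_right)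

lemma wedge_form_scale_left: "wedge_form (scale_form r \<alpha>) \<beta> = scale_form r (wedge_form \<alpha> \<beta>)"
  by (intro form_ext)
    (simp add: wedge_form_def scale_form_def wedge_def sum_distrib_left mult_ac)

lemma wedge_form_minus_left: "wedge_form (- \<alpha>) \<beta> = - wedge_form \<alpha> \<beta>"
  by (intro form_ext) (simp add: wedge_form_def wedge_def sum_negf)

lemma wedge_form_minus_right: "wedge_form \<alpha> (- \<beta>) = - wedge_form \<alpha> \<beta>"
  by (intro form_ext) (simp add: wedge_form_def wedge_def sum_negf)

lemma wedge_form_diff_left: "wedge_form (\<alpha> - \<alpha>') \<beta> = wedge_form \<alpha> \<beta> - wedge_form \<alpha>' \<beta>"
  using wedge_form_add_left[of \<alpha> "- \<alpha>'"] by (simp add: wedge_form_minus_left)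

lemma wedge_form_diff_right: "wedge_form \<alpha> (\<beta> - \<beta>') = wedge_form \<alpha> \<beta> - wedge_form \<alpha> \<beta>'"
  using wedge_form_add_right[of \<alpha> \<beta> "- \<beta>'"] by (simp add: wedge_form_minus_right)

lemma partial_form_wedge:
  assumes "differentiable_form \<alpha>" "differentiable_form \<beta>"
  shows "partial_form v (wedge_form \<alpha> \<beta>) =
    wedge_form (partial_form v \<alpha>) \<beta> + wedge_form \<alpha> (partial_form v \<beta>)"
proof (rule form_ext)
  fix c x vs
  show "partial_form v (wedge_form \<alpha> \<beta>) c x vs =
    (wedge_form (partial_form v \<alpha>) \<beta> + wedge_form \<alpha> (partial_form v \<beta>)) c x vs"
  proof (cases "x \<in> image_of c")
    case True
    note [simp] = differentiable_formD[OF assms(1) True] differentiable_formD[OF assms(2) True]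
    show ?thesis
      using True
      by (simp add: partial_form_def wedge_form_def wedge_def frechet_derivative_real_sum
          frechet_derivative_real_mult frechet_derivative_real_cmult algebra_simps sum.distrib)
  next
    case False
    then show ?thesis by (simp add: partial_form_def wedge_form_def wedge_def)
  qed
qed

section \<open>The exterior derivative: linearity, skewness and the Leibniz rule\<close>

lemma ext_d_Nil [simp]: "ext_d \<alpha> c x [] = 0"
  by (simp add: ext_d_def)

lemma ext_d_outside: "x \<notin> image_of c \<Longrightarrow> ext_d \<alpha> c x vs = 0"
  by (simp add: ext_d_def)

text \<open>Cartan's formula for the constant vector field v. It reduces statements about \<open>ext_d\<close> to
  inductions on the list of arguments.\<close>

lemma interior_ext_d: "interior_form v (ext_d \<alpha>) = partial_form v \<alpha> - ext_d (interior_form v \<alpha>)"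
  by (intro form_ext)
    (simp add: ext_d_def partial_form_def sum.lessThan_Suc_shift sum_negf del: sum.lessThan_Suc)

lemma ext_d_Cons: "ext_d \<alpha> c x (v # vs) = partial_form v \<alpha> c x vs - ext_d (interior_form v \<alpha>) c x vs"
  using fun_cong[OF fun_cong[OF fun_cong[OF interior_ext_d[of v \<alpha>]]], of c x vs] by simp

lemma ext_d_add:
  assumes "differentiable_form \<alpha>" "differentiable_form \<beta>"
  shows "ext_d (\<alpha> + \<beta>) = ext_d \<alpha> + ext_d \<beta>"
proof (rule form_ext)
  fix c x vs
  show "ext_d (\<alpha> + \<beta>) c x vs = (ext_d \<alpha> + ext_d \<beta>) c x vs"
    using differentiable_formD[OF assms(1)] differentiable_formD[OF assms(2)]
    by (simp add: ext_d_def frechet_derivative_real_add algebra_simps sum.distrib)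
qed

lemma ext_d_scale:
  assumes "differentiable_form \<alpha>"
  shows "ext_d (scale_form r \<alpha>) = scale_form r (ext_d \<alpha>)"
proof (rule form_ext)
  fix c x vs
  show "ext_d (scale_form r \<alpha>) c x vs = scale_form r (ext_d \<alpha>) c x vs"
    using differentiable_formD[OF assms]
    by (simp add: ext_d_def scale_form_def frechet_derivative_real_cmult algebra_simps sum_distrib_left)
qed

lemma scale_form_minus_one: "scale_form (-1) \<alpha> = - \<alpha>"
  by (intro form_ext) (simp add: scale_form_def)

lemma ext_d_minus: "differentiable_form \<alpha> \<Longrightarrow> ext_d (- \<alpha>) = - ext_d \<alpha>"
  using ext_d_scale[of \<alpha> "-1"] by (simp add: scale_form_minus_one)

lemma differentiable_form_minus [intro]: "differentiable_form \<alpha> \<Longrightarrow> differentiable_form (- \<alpha>)"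
  using differentiable_form_scale[of \<alpha> "-1"] by (simp add: scale_form_minus_one)

lemma ext_d_diff:
  assumes "differentiable_form \<alpha>" "differentiable_form \<beta>"
  shows "ext_d (\<alpha> - \<beta>) = ext_d \<alpha> - ext_d \<beta>"
  using ext_d_add[of \<alpha> "- \<beta>"] assms by (simp add: ext_d_minus differentiable_form_minus)

lemma ext_d_grade:
  assumes "differentiable_form \<alpha>"
  shows "ext_d (grade \<alpha>) = - grade (ext_d \<alpha>)"
proof (rule form_ext)
  fix c x vs
  have "ext_d (grade \<alpha>) c x vs = - grade (ext_d \<alpha>) c x vs" using assms
  proof (induction vs arbitrary: \<alpha>)
    case (Cons v vs)
    have "partial_form v (grade \<alpha>) c x vs = grade (partial_form v \<alpha>) c x vs"
      using differentiable_formD[OF Cons.prems]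
      by (simp add: partial_form_def grade_def invol_def frechet_derivative_real_cmult)
    \<comment> \<open>Two signs cancel: one from moving the contraction past \<open>grade\<close>,
      one from the induction hypothesis.\<close>
    moreover have "ext_d (interior_form v (grade \<alpha>)) c x vs = grade (ext_d (interior_form v \<alpha>)) c x vs"
      using Cons.IH[of "interior_form v \<alpha>"] Cons.prems
      by (simp add: interior_grade ext_d_minus differentiable_form_grade differentiable_form_interior
          del: interior_apply)
    ultimately show ?case
      unfolding ext_d_Cons grade_apply[of "ext_d _"] by (simp add: grade_apply algebra_simps)
  qed (simp add: grade_def invol_def)
  then show "ext_d (grade \<alpha>) c x vs = (- grade (ext_d \<alpha>)) c x vs" by simp
qed

lemma skew_form_partial [intro]:
  assumes "skew_form \<alpha>" "differentiable_form \<alpha>"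
  shows "skew_form (partial_form u \<alpha>)"
  unfolding skew_form_def
proof (intro allI skewI)
  fix c x us a b vs
  \<comment> \<open>Skewness at every point gives an equality of functions of y, which can then be
    differentiated.\<close>
  have "(\<lambda>y. \<alpha> c y (us @ a # b # vs)) = (\<lambda>y. -1 * \<alpha> c y (us @ b # a # vs))"
    using skewD[OF skew_formD[OF assms(1)], of c _ us a b vs] by simp
  then show "partial_form u \<alpha> c x (us @ a # b # vs) = - partial_form u \<alpha> c x (us @ b # a # vs)"
    unfolding partial_form_def
    using frechet_derivative_real_cmult[OF differentiable_formD[OF assms(2)], of x c "-1"]
    by simp
qed

lemma partial_form_interior: "partial_form v (interior_form u \<alpha>) c x vs = partial_form v \<alpha> c x (u # vs)"
  by (simp add: partial_form_def)

lemma skew_form_ext_d [intro]: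
  assumes "skew_form \<alpha>" "differentiable_form \<alpha>"
  shows "skew_form (ext_d \<alpha>)"
  unfolding skew_form_def
proof (intro allI skewI)
  fix c x us a b vs
  show "ext_d \<alpha> c x (us @ a # b # vs) = - ext_d \<alpha> c x (us @ b # a # vs)"
    using assms
  proof (induction us arbitrary: \<alpha>)
    case Nil
    \<comment> \<open>By Cartan's formula applied twice, the value on a, b is a difference of two
      partial derivatives, visibly skew, plus this iterated contraction.\<close>
    have "ext_d (interior_form b (interior_form a \<alpha>)) = - ext_d (interior_form a (interior_form b \<alpha>))"
      using Nil by (subst interior_swap) (auto intro!: ext_d_minus)
    moreover have "partial_form a \<alpha> c x (b # vs) = partial_form a (interior_form b \<alpha>) c x vs"
      "partial_form b \<alpha> c x (a # vs) = partial_form b (interior_form a \<alpha>) c x vs"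
      by (simp_all add: partial_form_interior)
    ultimately show ?case by (simp add: ext_d_Cons)
  next
    case (Cons u us)
    have "partial_form u \<alpha> c x (us @ a # b # vs) = - partial_form u \<alpha> c x (us @ b # a # vs)"
      by (intro skewD skew_formD skew_form_partial Cons.prems)
    moreover have "ext_d (interior_form u \<alpha>) c x (us @ a # b # vs) =
        - ext_d (interior_form u \<alpha>) c x (us @ b # a # vs)"
      by (intro Cons.IH skew_form_interior differentiable_form_interior Cons.prems)
    ultimately show ?case by (simp add: ext_d_Cons)
  qed
qed

text \<open>After contraction with v, Cartan's formula turns both sides into the derivative along v
  of the product minus the Leibniz expressions for two other pairs: \<alpha> contracted with
  \<beta>, and \<open>grade \<alpha>\<close> with \<beta> contracted. The induction hypothesis
  covers both; in the second, \<open>grade\<close> is applied twice and disappears.\<close>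

lemma ext_d_wedge:
  assumes "differentiable_form \<alpha>" "differentiable_form \<beta>"
  shows "ext_d (wedge_form \<alpha> \<beta>) = wedge_form (ext_d \<alpha>) \<beta> + wedge_form (grade \<alpha>) (ext_d \<beta>)"
proof (rule form_ext)
  fix c x vs
  show "ext_d (wedge_form \<alpha> \<beta>) c x vs =
      (wedge_form (ext_d \<alpha>) \<beta> + wedge_form (grade \<alpha>) (ext_d \<beta>)) c x vs"
    using assms
  proof (induction vs arbitrary: \<alpha> \<beta>)
    case Nil
    then show ?case by (simp add: wedge_form_def)
  next
    case (Cons v vs)
    note d = differentiable_form_interior[OF Cons.prems(1), of v]
      differentiable_form_interior[OF Cons.prems(2), of v] differentiable_form_grade[OF Cons.prems(1)]
    have "interior_form v (wedge_form (ext_d \<alpha>) \<beta> + wedge_form (grade \<alpha>) (ext_d \<beta>)) =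
        partial_form v (wedge_form \<alpha> \<beta>)
        - (wedge_form (ext_d (interior_form v \<alpha>)) \<beta> + wedge_form (grade (interior_form v \<alpha>)) (ext_d \<beta>))
        - (wedge_form (ext_d (grade \<alpha>)) (interior_form v \<beta>)
           + wedge_form \<alpha> (ext_d (interior_form v \<beta>)))"
      by (simp add: partial_form_wedge[OF Cons.prems] interior_add interior_wedge interior_ext_d
          wedge_form_diff_left wedge_form_diff_right wedge_form_minus_left interior_grade
          ext_d_grade[OF Cons.prems(1)])
    moreover have "interior_form v (ext_d (wedge_form \<alpha> \<beta>)) c x vs =
        (partial_form v (wedge_form \<alpha> \<beta>)
        - (wedge_form (ext_d (interior_form v \<alpha>)) \<beta> + wedge_form (grade (interior_form v \<alpha>)) (ext_d \<beta>))
        - (wedge_form (ext_d (grade \<alpha>)) (interior_form v \<beta>)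
           + wedge_form \<alpha> (ext_d (interior_form v \<beta>)))) c x vs"
      using Cons.IH[OF d(1) Cons.prems(2)] Cons.IH[OF d(3) d(2)] d Cons.prems
      by (simp add: interior_ext_d interior_wedge ext_d_add differentiable_form_wedge
          del: interior_apply)
    ultimately have "interior_form v (ext_d (wedge_form \<alpha> \<beta>)) c x vs =
        interior_form v (wedge_form (ext_d \<alpha>) \<beta> + wedge_form (grade \<alpha>) (ext_d \<beta>)) c x vs"
      by (simp only:)
    then show ?case by (simp only: interior_apply)
  qed
qed

section \<open>Koszul's operator\<close>

lemma sum_rotate3:
  "(\<Sum>i\<in>A. \<Sum>j\<in>B. \<Sum>k\<in>C. f i j k) = (\<Sum>j\<in>B. \<Sum>k\<in>C. \<Sum>i\<in>A. f i j k)"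
  by (subst sum.swap) (intro sum.cong refl sum.swap)

lemma sum_rotate4:
  "(\<Sum>i\<in>A. \<Sum>j\<in>B. \<Sum>k\<in>C. \<Sum>l\<in>D. f i j k l) =
    (\<Sum>j\<in>B. \<Sum>k\<in>C. \<Sum>l\<in>D. \<Sum>i\<in>A. f i j k l)"
  by (subst sum.swap) (intro sum.cong refl sum_rotate3)

lemma sum_exchange_pairs:
  "(\<Sum>i\<in>A. \<Sum>j\<in>B. \<Sum>k\<in>C. \<Sum>l\<in>D. f i j k l) =
    (\<Sum>k\<in>C. \<Sum>l\<in>D. \<Sum>i\<in>A. \<Sum>j\<in>B. f i j k l)"
  by (rule trans[OF sum_rotate4 sum_rotate4])

text \<open>Reading \<open>G p q r s\<close> as the derivative along p of \<alpha> on q, r, s, the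
  bracket is d\<alpha> on l, k, j, i. The product of the two m changes sign under exchange of i and
  j and is unchanged when the index pairs are exchanged; together with the cyclic symmetry of G in
  its last three slots, each of the four signed summands contributes -1 times the sum on the
  right.\<close>

lemma sum_skew_contraction:
  fixes m :: "'i \<Rightarrow> 'i \<Rightarrow> real" and G :: "'i \<Rightarrow> 'i \<Rightarrow> 'i \<Rightarrow> 'i \<Rightarrow> real"
  assumes m: "\<And>i j. m i j = - m j i"
    and G: "\<And>p q r s. G p q r s = - G p r q s" "\<And>p q r s. G p q r s = - G p q s r"
  shows "(\<Sum>i\<in>B. \<Sum>j\<in>B. m i j * (\<Sum>k\<in>B. \<Sum>l\<in>B. m k l *
      (G l k j i - G k l j i + G j l k i - G i l k j))) =
    - 4 * (\<Sum>i\<in>B. \<Sum>j\<in>B. m i j * (\<Sum>k\<in>B. \<Sum>l\<in>B. m k l * G i l k j))"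
proof -
  define Q where "Q F = (\<Sum>i\<in>B. \<Sum>j\<in>B. m i j * (\<Sum>k\<in>B. \<Sum>l\<in>B. m k l * F i j k l))" for F
  have swap: "Q (\<lambda>i j k l. F j i k l) = - Q F" for F
    unfolding Q_def sum_negf[symmetric] by (subst sum.swap, subst m) (simp add: sum_negf)
  have exchange: "Q (\<lambda>i j k l. F k l i j) = Q F" for F
  proof -
    have "Q F = (\<Sum>i\<in>B. \<Sum>j\<in>B. \<Sum>k\<in>B. \<Sum>l\<in>B. m i j * (m k l * F i j k l))"
      by (simp only: Q_def sum_distrib_left)
    also have "\<dots> = (\<Sum>k\<in>B. \<Sum>l\<in>B. \<Sum>i\<in>B. \<Sum>j\<in>B. m k l * (m i j * F i j k l))"
      by (subst sum_exchange_pairs) (simp only: mult.left_commute)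
    also have "\<dots> = Q (\<lambda>i j k l. F k l i j)"
      by (simp only: Q_def sum_distrib_left)
    finally show ?thesis ..
  qed
  have neg: "Q (\<lambda>i j k l. - F i j k l) = - Q F" for F
    by (simp add: Q_def sum_negf)
  have cyc: "G p q r s = G p s q r" for p q r s
    using G(1)[of p s q r] G(2)[of p q s r] by simp
  define q where "q = Q (\<lambda>i j k l. G i l k j)"
  have 3: "Q (\<lambda>i j k l. G j l k i) = - q"
    unfolding q_def by (rule swap)
  have 1: "Q (\<lambda>i j k l. G l k j i) = - q"
  proof -
    have "Q (\<lambda>i j k l. G l k j i) = Q (\<lambda>i j k l. G j i l k)"
      by (rule exchange)
    also have "\<dots> = Q (\<lambda>i j k l. G j l k i)"
      by (intro arg_cong[of _ _ Q] ext) (metis cyc)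
    finally show ?thesis using 3 by simp
  qed
  have 2: "Q (\<lambda>i j k l. G k l j i) = q"
  proof -
    have "Q (\<lambda>i j k l. G k l j i) = Q (\<lambda>i j k l. G i j l k)"
      by (rule exchange)
    also have "\<dots> = q"
      unfolding q_def by (intro arg_cong[of _ _ Q] ext) (metis cyc)
    finally show ?thesis .
  qed
  have "Q (\<lambda>i j k l. G l k j i - G k l j i + G j l k i - G i l k j) =
      Q (\<lambda>i j k l. G l k j i) - Q (\<lambda>i j k l. G k l j i) + Q (\<lambda>i j k l. G j l k i) - q"
    unfolding q_def Q_def by (simp add: algebra_simps sum.distrib sum_subtractf)
  then have "Q (\<lambda>i j k l. G l k j i - G k l j i + G j l k i - G i l k j) = - 4 * q"
    unfolding 1 2 3 by simp
  then show ?thesis unfolding q_def Q_def .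
qed

text \<open>Contraction with a totally skew a sees only the skew part of S. Averaging over three
  relabellings of the indices makes the factor given by the hypothesis appear; in the application
  this is the Jacobi identity.\<close>

lemma sum_cyclic_contraction:
  fixes S a :: "'i \<Rightarrow> 'i \<Rightarrow> 'i \<Rightarrow> real"
  assumes S: "\<And>j k l. S j k l - S k j l + S l j k = 0"
    and a: "\<And>p q r. a p q r = - a q p r" "\<And>p q r. a p q r = - a p r q"
  shows "(\<Sum>j\<in>B. \<Sum>k\<in>B. \<Sum>l\<in>B. S j k l * a l k j) = 0"
proof -
  define T where "T F = (\<Sum>j\<in>B. \<Sum>k\<in>B. \<Sum>l\<in>B. F j k l :: real)" for F
  have 1: "T (\<lambda>j k l. F k j l) = T F" for F
    unfolding T_def by (rule sum.swap)
  have 2: "T (\<lambda>j k l. F l j k) = T F" for F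
    unfolding T_def by (rule sum_rotate3[symmetric])
  let ?F = "\<lambda>j k l. S j k l * a l k j"
  have "3 * T ?F = T ?F + T (\<lambda>j k l. ?F k j l) + T (\<lambda>j k l. ?F l j k)"
    using 1[of ?F] 2[of ?F] by simp
  also have "\<dots> = T (\<lambda>j k l. ?F j k l + ?F k j l + ?F l j k)"
    unfolding T_def by (simp add: sum.distrib)
  also have "\<dots> = T (\<lambda>j k l. 0)"
  proof (intro arg_cong[of _ _ T] ext)
    fix j k l
    have "a l j k = - a l k j" "a k j l = a l k j"
      using a(2)[of l j k] a(1)[of k j l] a(2)[of j k l] a(1)[of j l k] by simp_all
    then have "?F j k l + ?F k j l + ?F l j k = (S j k l - S k j l + S l j k) * a l k j"
      by (simp add: algebra_simps)
    then show "?F j k l + ?F k j l + ?F l j k = 0" unfolding S by simp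
  qed
  finally show ?thesis by (simp add: T_def)
qed

text \<open>Exchanging two pairs takes four adjacent swaps.\<close>

lemma skew_swap_pairs:
  assumes "skew f"
  shows "f (a # b # c # d # vs) = f (c # d # a # b # vs)"
  using skewD[OF assms, of "[a]" b c "d # vs"] skewD[OF assms, of "[a, c]" b d vs]
    skewD[OF assms, of "[]" a c "d # b # vs"] skewD[OF assms, of "[c]" a d "b # vs"]
  by simp

text \<open>What remains of a Poisson structure in a single chart. \<open>jacobi\<close> is half of
  the Schouten bracket of w with itself, evaluated on three covectors.\<close>

locale poisson_bivector =
  fixes B :: "'e::real_inner set" and w :: "('a, 'e) multivector"
  assumes finite_B: "finite B"
    and w_skew: "\<And>c x \<xi> \<eta>. w c x [\<xi>, \<eta>] = - w c x [\<eta>, \<xi>]"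
    and w_differentiable:
      "\<And>c x \<xi> \<eta>. x \<in> image_of c \<Longrightarrow> (\<lambda>y. w c y [\<xi>, \<eta>]) differentiable (at x)"
    and jacobi: "\<And>c x \<xi> \<eta> \<zeta>. x \<in> image_of c \<Longrightarrow>
      (\<Sum>b\<in>B. w c x [\<xi>, coframe b] * partial_multivector b w c x [\<eta>, \<zeta>])
      - (\<Sum>b\<in>B. w c x [\<eta>, coframe b] * partial_multivector b w c x [\<xi>, \<zeta>])
      + (\<Sum>b\<in>B. w c x [\<zeta>, coframe b] * partial_multivector b w c x [\<xi>, \<eta>]) = 0"
begin

section \<open>Contraction with w, and its commutators with d and \<delta>\<close>

abbreviation W :: "('a, 'e) form \<Rightarrow> ('a, 'e) form" where
  "W \<equiv> w_contract B w"

abbreviation \<delta> :: "('a, 'e) form \<Rightarrow> ('a, 'e) form" where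
  "\<delta> \<equiv> koszul B w"

text \<open>Contraction with the derivative of w along v, that is, the commutator of the derivative
  along v with W.\<close>

definition dw_contract :: "'e \<Rightarrow> ('a, 'e) form \<Rightarrow> ('a, 'e) form" where
  "dw_contract v \<alpha> c x vs =
     (if x \<in> image_of c
      then 1 / 2 * (\<Sum>i\<in>B. \<Sum>j\<in>B.
        partial_multivector v w c x [coframe i, coframe j] * \<alpha> c x (j # i # vs))
      else 0)"

lemma w_contract_apply:
  "W \<alpha> c x vs = 1 / 2 * (\<Sum>i\<in>B. \<Sum>j\<in>B. w c x [coframe i, coframe j] * \<alpha> c x (j # i # vs))"
  by (simp add: w_contract_def left_contract_def)

lemma w_contract_add: "W (\<alpha> + \<beta>) = W \<alpha> + W \<beta>"
  by (intro form_ext) (simp add: w_contract_apply algebra_simps sum.distrib)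

lemma w_contract_minus: "W (- \<alpha>) = - W \<alpha>"
  by (intro form_ext) (simp add: w_contract_apply sum_negf)

lemma w_contract_diff: "W (\<alpha> - \<beta>) = W \<alpha> - W \<beta>"
  using w_contract_add[of \<alpha> "- \<beta>"] by (simp add: w_contract_minus)

lemma w_contract_scale: "W (scale_form r \<alpha>) = scale_form r (W \<alpha>)"
  by (intro form_ext) (simp add: w_contract_apply scale_form_def sum_distrib_left mult_ac)

lemma w_contract_grade: "W (grade \<alpha>) = grade (W \<alpha>)"
  by (intro form_ext) (simp add: w_contract_apply grade_apply sum_distrib_left mult_ac)

text \<open>W fills two arguments, so v moves past an even number of them.\<close>

lemma w_contract_interior:
  assumes "skew_form \<alpha>"
  shows "W (interior_form v \<alpha>) = interior_form v (W \<alpha>)"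
proof (rule form_ext)
  fix c x vs
  have "\<alpha> c x (v # j # i # vs) = \<alpha> c x (j # i # v # vs)" for i j
    using skewD[OF skew_formD[OF assms, of c x], of "[]" v j "i # vs"]
      skewD[OF skew_formD[OF assms, of c x], of "[j]" v i vs] by simp
  then show "W (interior_form v \<alpha>) c x vs = interior_form v (W \<alpha>) c x vs"
    by (simp add: w_contract_apply)
qed

lemma differentiable_form_w_contract [intro]:
  assumes "differentiable_form \<alpha>"
  shows "differentiable_form (W \<alpha>)"
  unfolding differentiable_form_def
proof (intro allI impI)
  fix c :: "('a, 'e) chart" and x vs assume "x \<in> image_of c"
  then show "(\<lambda>y. W \<alpha> c y vs) differentiable at x"
    using differentiable_formD[OF assms] w_differentiable finite_B
    unfolding w_contract_apply
    by (intro differentiable_mult differentiable_sum differentiable_const ballI) auto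
qed

lemma skew_form_w_contract [intro]:
  assumes "skew_form \<alpha>"
  shows "skew_form (W \<alpha>)"
  unfolding skew_form_def
proof (intro allI skewI)
  fix c x us a b vs
  have "\<alpha> c x (j # i # us @ a # b # vs) = - \<alpha> c x (j # i # us @ b # a # vs)" for i j
    using skewD[OF skew_formD[OF assms], of c x "j # i # us" a b vs] by simp
  then show "W \<alpha> c x (us @ a # b # vs) = - W \<alpha> c x (us @ b # a # vs)"
    by (simp add: w_contract_apply sum_negf)
qed

lemma partial_form_w_contract:
  assumes "differentiable_form \<alpha>"
  shows "partial_form v (W \<alpha>) = dw_contract v \<alpha> + W (partial_form v \<alpha>)"
proof (rule form_ext)
  fix c x vs
  show "partial_form v (W \<alpha>) c x vs = (dw_contract v \<alpha> + W (partial_form v \<alpha>)) c x vs"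
  proof (cases "x \<in> image_of c")
    case True
    note d [simp] = differentiable_formD[OF assms True] w_differentiable[OF True]
    have "partial_form v (W \<alpha>) c x vs = 1 / 2 * (\<Sum>i\<in>B. \<Sum>j\<in>B.
        w c x [coframe i, coframe j] * frechet_derivative (\<lambda>y. \<alpha> c y (j # i # vs)) (at x) v +
        frechet_derivative (\<lambda>y. w c y [coframe i, coframe j]) (at x) v * \<alpha> c x (j # i # vs))"
      using True finite_B unfolding partial_form_def w_contract_apply
      by (simp add: frechet_derivative_real_cmult frechet_derivative_real_sum
          frechet_derivative_real_mult del: times_divide_eq_left)
    then show ?thesis
      using True
      by (simp add: partial_form_def w_contract_apply dw_contract_def partial_multivector_def
          sum.distrib algebra_simps)
  next
    case False
    then show ?thesis by (simp add: partial_form_def dw_contract_def w_contract_apply)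
  qed
qed

text \<open>Contractions with two bivectors commute, being even.\<close>

lemma w_contract_dw_contract:
  assumes "skew_form \<alpha>"
  shows "W (dw_contract v \<alpha>) = dw_contract v (W \<alpha>)"
proof (rule form_ext)
  fix c x vs
  have "(\<Sum>i\<in>B. \<Sum>j\<in>B. w c x [coframe i, coframe j] * (\<Sum>k\<in>B. \<Sum>l\<in>B.
      partial_multivector v w c x [coframe k, coframe l] * \<alpha> c x (l # k # j # i # vs))) =
    (\<Sum>i\<in>B. \<Sum>j\<in>B. partial_multivector v w c x [coframe i, coframe j] * (\<Sum>k\<in>B. \<Sum>l\<in>B.
      w c x [coframe k, coframe l] * \<alpha> c x (l # k # j # i # vs)))"
    unfolding sum_distrib_left
    by (subst sum_exchange_pairs, subst skew_swap_pairs[OF skew_formD[OF assms]])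
      (simp only: mult.left_commute)
  then show "W (dw_contract v \<alpha>) c x vs = dw_contract v (W \<alpha>) c x vs"
    by (simp add: w_contract_apply dw_contract_def flip: sum_divide_distrib)
qed

lemma skew_form_koszul [intro]:
  "skew_form \<alpha> \<Longrightarrow> differentiable_form \<alpha> \<Longrightarrow> skew_form (\<delta> \<alpha>)"
  unfolding koszul_def by blast

text \<open>The analogue of Cartan's formula for \<delta>: since W commutes with contraction by v,
  the anticommutator of that contraction with [W, d] is the commutator of W with the derivative
  along v.\<close>

lemma interior_koszul:
  assumes "skew_form \<alpha>" "differentiable_form \<alpha>"
  shows "interior_form v (\<delta> \<alpha>) = - dw_contract v \<alpha> - \<delta> (interior_form v \<alpha>)"
  unfolding koszul_def interior_diff interior_ext_d w_contract_interior[OF assms(1)]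
    w_contract_interior[OF skew_form_ext_d[OF assms], symmetric] partial_form_w_contract[OF assms(2)]
    w_contract_diff
  by simp

text \<open>On the empty list d W W vanishes, so the claim is W W d = 2 W d W there, a statement
  about the component of degree 3. The left side is -q; the right side is -(q + r), and r vanishes
  by the Jacobi identity.\<close>

lemma koszul_w_contract_Nil:
  assumes "skew_form \<alpha>" "differentiable_form \<alpha>"
  shows "\<delta> (W \<alpha>) c x [] = W (\<delta> \<alpha>) c x []"
proof (cases "x \<in> image_of c")
  case False
  then show ?thesis by (simp add: koszul_def w_contract_apply ext_d_outside)
next
  case True
  let ?m = "\<lambda>i j. w c x [coframe i, coframe j]"
  let ?G = "\<lambda>p q r s. partial_form p \<alpha> c x [q, r, s]"
  let ?N = "\<lambda>i k l. partial_multivector i w c x [coframe k, coframe l]"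
  \<comment> \<open>In q the derivative falls on \<alpha>, in r on w.\<close>
  define q where "q = (\<Sum>i\<in>B. \<Sum>j\<in>B. ?m i j * (\<Sum>k\<in>B. \<Sum>l\<in>B. ?m k l * ?G i l k j))"
  define r where "r = (\<Sum>i\<in>B. \<Sum>j\<in>B. ?m i j * (\<Sum>k\<in>B. \<Sum>l\<in>B. ?N i k l * \<alpha> c x [l, k, j]))"
  have skew_partial: "skew (partial_form p \<alpha> c x)" for p
    by (intro skew_formD skew_form_partial assms)
  have "(\<Sum>i\<in>B. \<Sum>j\<in>B. ?m i j * (\<Sum>k\<in>B. \<Sum>l\<in>B. ?m k l *
      (?G l k j i - ?G k l j i + ?G j l k i - ?G i l k j))) = - 4 * q"
    unfolding q_def
  proof (rule sum_skew_contraction)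
    show "?m i j = - ?m j i" for i j by (rule w_skew)
    show "?G p q r s = - ?G p r q s" for p q r s using skewD[OF skew_partial, of p "[]" q r "[s]"] by simp
    show "?G p q r s = - ?G p q s r" for p q r s using skewD[OF skew_partial, of p "[q]" r s "[]"] by simp
  qed
  moreover have "ext_d \<alpha> c x [l, k, j, i] = ?G l k j i - ?G k l j i + ?G j l k i - ?G i l k j"
    for i j k l
    by (simp add: ext_d_Cons partial_form_interior del: interior_apply)
  ultimately have WWd: "W (W (ext_d \<alpha>)) c x [] = - q"
    by (simp add: w_contract_apply flip: sum_divide_distrib)
  have "r = (\<Sum>j\<in>B. \<Sum>k\<in>B. \<Sum>l\<in>B. \<Sum>i\<in>B. ?m i j * ?N i k l * \<alpha> c x [l, k, j])"
    unfolding r_def sum_distrib_left mult.assoc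
    by (rule sum_rotate4)
  \<comment> \<open>Swapping the arguments of the first w puts the derivation index i second, which
    gives the inner sum the shape of \<open>jacobi\<close>.\<close>
  also have "\<dots> = - (\<Sum>j\<in>B. \<Sum>k\<in>B. \<Sum>l\<in>B. (\<Sum>i\<in>B. ?m j i * ?N i k l) * \<alpha> c x [l, k, j])"
    by (subst w_skew) (simp add: sum_negf sum_distrib_right)
  also have "(\<Sum>j\<in>B. \<Sum>k\<in>B. \<Sum>l\<in>B. (\<Sum>i\<in>B. ?m j i * ?N i k l) * \<alpha> c x [l, k, j]) = 0"
  proof (rule sum_cyclic_contraction[where a = "\<lambda>p q r. \<alpha> c x [p, q, r]"])
    note skew = skewD[OF skew_formD[OF assms(1)], of c x]
    show "\<alpha> c x [p, q, r] = - \<alpha> c x [q, p, r]" for p q r using skew[of "[]" p q "[r]"] by simp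
    show "\<alpha> c x [p, q, r] = - \<alpha> c x [p, r, q]" for p q r using skew[of "[p]" q r "[]"] by simp
  qed (rule jacobi[OF True])
  finally have r: "r = 0" by simp
  have "W (ext_d (W \<alpha>)) c x [] =
      1 / 2 * (\<Sum>i\<in>B. \<Sum>j\<in>B. ?m i j * (partial_form j (W \<alpha>) c x [i] - partial_form i (W \<alpha>) c x [j]))"
    by (simp add: w_contract_apply[of "ext_d _"] ext_d_Cons partial_form_interior del: interior_apply)
  also have "\<dots> = 1 / 2 * ((\<Sum>i\<in>B. \<Sum>j\<in>B. ?m i j * partial_form j (W \<alpha>) c x [i])
      - (\<Sum>i\<in>B. \<Sum>j\<in>B. ?m i j * partial_form i (W \<alpha>) c x [j]))"
    by (simp add: algebra_simps sum_subtractf)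
  \<comment> \<open>The two sums are opposite, so the difference doubles and cancels the factor 1 /
    2.\<close>
  also have "(\<Sum>i\<in>B. \<Sum>j\<in>B. ?m i j * partial_form j (W \<alpha>) c x [i]) =
      - (\<Sum>i\<in>B. \<Sum>j\<in>B. ?m i j * partial_form i (W \<alpha>) c x [j])"
    by (subst sum.swap, subst w_skew) (simp add: sum_negf)
  also have "(\<Sum>i\<in>B. \<Sum>j\<in>B. ?m i j * partial_form i (W \<alpha>) c x [j]) = 1 / 2 * (r + q)"
    using True
    by (simp add: partial_form_w_contract[OF assms(2)] dw_contract_def w_contract_apply r_def q_def
        algebra_simps sum.distrib sum_distrib_left)
  finally have "W (ext_d (W \<alpha>)) c x [] = - (1 / 2) * q" using r by simp
  then show ?thesis
    using WWd by (simp add: koszul_def w_contract_diff)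
qed

text \<open>Both sides anticommute with contractions up to the same term, so it suffices to compare them
  on the empty list, where the Jacobi identity enters.\<close>

lemma koszul_w_contract:
  assumes "skew_form \<alpha>" "differentiable_form \<alpha>"
  shows "\<delta> (W \<alpha>) = W (\<delta> \<alpha>)"
proof (rule form_ext)
  fix c x vs
  show "\<delta> (W \<alpha>) c x vs = W (\<delta> \<alpha>) c x vs"
    using assms
  proof (induction vs arbitrary: \<alpha>)
    case Nil
    then show ?case by (rule koszul_w_contract_Nil)
  next
    case (Cons v vs)
    have "interior_form v (\<delta> (W \<alpha>)) = - dw_contract v (W \<alpha>) - \<delta> (W (interior_form v \<alpha>))"
      using Cons.prems by (subst interior_koszul) (auto simp: w_contract_interior)
    moreover have "interior_form v (W (\<delta> \<alpha>)) = - W (dw_contract v \<alpha>) - W (\<delta> (interior_form v \<alpha>))"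
      using Cons.prems
      by (subst w_contract_interior[symmetric])
        (auto simp: interior_koszul w_contract_diff w_contract_minus)
    moreover have "\<delta> (W (interior_form v \<alpha>)) c x vs = W (\<delta> (interior_form v \<alpha>)) c x vs"
      by (intro Cons.IH skew_form_interior differentiable_form_interior Cons.prems)
    ultimately have "interior_form v (\<delta> (W \<alpha>)) c x vs = interior_form v (W (\<delta> \<alpha>)) c x vs"
      by (simp add: w_contract_dw_contract[OF Cons.prems(1)] del: interior_apply)
    then show ?case by (simp only: interior_apply)
  qed
qed

end

section \<open>The quantum exterior product\<close>

definition interior_right :: "'e \<Rightarrow> ('a, 'e) form \<Rightarrow> ('a, 'e) form" where
  "interior_right v \<alpha> c x = \<alpha> c x \<stileturn> v"

lemma interior_right_apply [simp]: "interior_right v \<alpha> c x vs = \<alpha> c x (vs @ [v])"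
  by (simp add: interior_right_def right_contract_def)

lemma interior_right_add: "interior_right v (\<alpha> + \<beta>) = interior_right v \<alpha> + interior_right v \<beta>"
  by (intro form_ext) simp

lemma interior_right_scale: "interior_right v (scale_form r \<alpha>) = scale_form r (interior_right v \<alpha>)"
  by (intro form_ext) (simp add: scale_form_def)

lemma skew_form_interior_right [intro]: "skew_form \<alpha> \<Longrightarrow> skew_form (interior_right v \<alpha>)"
  unfolding skew_form_def interior_right_def by blast

lemma differentiable_form_interior_right [intro]:
  "differentiable_form \<alpha> \<Longrightarrow> differentiable_form (interior_right v \<alpha>)"
  unfolding differentiable_form_def by simp

lemma scale_form_add: "scale_form r (\<alpha> + \<beta>) = scale_form r \<alpha> + scale_form r \<beta>"
  by (intro form_ext) (simp add: scale_form_def algebra_simps)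

lemma scale_form_diff: "scale_form r (\<alpha> - \<beta>) = scale_form r \<alpha> - scale_form r \<beta>"
  by (intro form_ext) (simp add: scale_form_def algebra_simps)

lemma scale_form_zero [simp]: "scale_form 0 \<alpha> = 0" "scale_form r 0 = 0"
  by (intro form_ext; simp add: scale_form_def)+

lemma scale_form_Suc: "scale_form (real (Suc n)) \<alpha> = \<alpha> + scale_form (real n) \<alpha>"
  by (intro form_ext) (simp add: scale_form_def algebra_simps)

lemma scale_form_scale: "scale_form r (scale_form s \<alpha>) = scale_form (r * s) \<alpha>"
  by (intro form_ext) (simp add: scale_form_def)

lemma differentiable_form_zero [simp, intro]: "differentiable_form 0"
  by (simp add: differentiable_form_def)

lemma differentiable_form_sum [intro]:
  "(\<And>i. i \<in> I \<Longrightarrow> differentiable_form (f i)) \<Longrightarrow> differentiable_form (\<Sum>i\<in>I. f i)"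
  by (induction I rule: infinite_finite_induct) auto

lemma ext_d_zero [simp]: "ext_d 0 = 0"
  using ext_d_scale[of 0 0] by simp

lemma ext_d_sum:
  "(\<And>i. i \<in> I \<Longrightarrow> differentiable_form (f i)) \<Longrightarrow> ext_d (\<Sum>i\<in>I. f i) = (\<Sum>i\<in>I. ext_d (f i))"
  by (induction I rule: infinite_finite_induct) (simp_all add: ext_d_add differentiable_form_sum)

context poisson_bivector
begin

lemma koszul_add:
  "differentiable_form \<alpha> \<Longrightarrow> differentiable_form \<beta> \<Longrightarrow> \<delta> (\<alpha> + \<beta>) = \<delta> \<alpha> + \<delta> \<beta>"
  by (simp add: koszul_def ext_d_add w_contract_add differentiable_form_w_contract)

lemma koszul_diff:
  "differentiable_form \<alpha> \<Longrightarrow> differentiable_form \<beta> \<Longrightarrow> \<delta> (\<alpha> - \<beta>) = \<delta> \<alpha> - \<delta> \<beta>"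
  by (simp add: koszul_def ext_d_diff w_contract_diff differentiable_form_w_contract)

lemma koszul_scale: "differentiable_form \<alpha> \<Longrightarrow> \<delta> (scale_form r \<alpha>) = scale_form r (\<delta> \<alpha>)"
  by (simp add: koszul_def ext_d_scale w_contract_scale scale_form_diff differentiable_form_w_contract)

lemma koszul_zero [simp]: "\<delta> 0 = 0"
  using koszul_scale[of 0 0] by simp

lemma koszul_sum:
  "(\<And>i. i \<in> I \<Longrightarrow> differentiable_form (f i)) \<Longrightarrow> \<delta> (\<Sum>i\<in>I. f i) = (\<Sum>i\<in>I. \<delta> (f i))"
  by (induction I rule: infinite_finite_induct) (simp_all add: koszul_add differentiable_form_sum)

text \<open>The unnormalised coefficient C_n. The recursion splits off the first entries of the
  index tuples, which are the ones contracted first.\<close>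

primrec contracted_wedge :: "nat \<Rightarrow> ('a, 'e) form \<Rightarrow> ('a, 'e) form \<Rightarrow> ('a, 'e) form" where
  "contracted_wedge 0 \<alpha> \<beta> = wedge_form \<alpha> \<beta>"
| "contracted_wedge (Suc n) \<alpha> \<beta> = (\<lambda>c x vs. \<Sum>i\<in>B. \<Sum>j\<in>B. w c x [coframe i, coframe j] *
     contracted_wedge n (interior_right i \<alpha>) (interior_form j \<beta>) c x vs)"

text \<open>A tuple of length n + 1 is a head and a tail, and \<open>foldl\<close> applies the head
  first, just as the recursion does.\<close>

lemma quantum_term_contracted_wedge:
  "quantum_term B w n \<alpha> \<beta> = scale_form (1 / fact n) (contracted_wedge n \<alpha> \<beta>)"
proof (rule form_ext)
  fix c x vs
  let ?L = "\<lambda>n. {is. set is \<subseteq> B \<and> length is = n}"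
  have lists_Suc: "(\<Sum>is\<in>?L (Suc n). F is) = (\<Sum>i\<in>B. \<Sum>is\<in>?L n. F (i # is))"
    for n and F :: "'e list \<Rightarrow> real"
  proof -
    have "(\<Sum>is\<in>?L (Suc n). F is) = (\<Sum>(is, i)\<in>?L n \<times> B. F (i # is))"
      unfolding lists_length_Suc_eq
      by (subst sum.reindex) (auto simp: inj_on_def split_def)
    then show ?thesis by (subst sum.swap) (simp add: sum.cartesian_product)
  qed
  have "(\<Sum>is\<in>?L n. \<Sum>js\<in>?L n. (\<Prod>k<n. w c x [coframe (is ! k), coframe (js ! k)]) *
      wedge (foldl (\<lambda>f i. f \<stileturn> i) (\<alpha> c x) is) (foldl (\<lambda>f j. j \<turnstile> f) (\<beta> c x) js) vs) =
    contracted_wedge n \<alpha> \<beta> c x vs"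
  proof (induction n arbitrary: \<alpha> \<beta>)
    case 0
    have "?L 0 = {[]}" by auto
    then show ?case by (simp only: wedge_form_def contracted_wedge.simps) simp
  next
    case (Suc n)
    have "contracted_wedge (Suc n) \<alpha> \<beta> c x vs = (\<Sum>i\<in>B. \<Sum>j\<in>B. w c x [coframe i, coframe j] *
      (\<Sum>is\<in>?L n. \<Sum>js\<in>?L n. (\<Prod>k<n. w c x [coframe (is ! k), coframe (js ! k)]) *
      wedge (foldl (\<lambda>f i. f \<stileturn> i) (interior_right i \<alpha> c x) is)
        (foldl (\<lambda>f j. j \<turnstile> f) (interior_form j \<beta> c x) js) vs))"
      by (simp only: contracted_wedge.simps Suc.IH)
    also have "\<dots> = (\<Sum>i\<in>B. \<Sum>j\<in>B. \<Sum>is\<in>?L n. \<Sum>js\<in>?L n.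
      (\<Prod>k<Suc n. w c x [coframe ((i # is) ! k), coframe ((j # js) ! k)]) *
      wedge (foldl (\<lambda>f i. f \<stileturn> i) (\<alpha> c x) (i # is)) (foldl (\<lambda>f j. j \<turnstile> f) (\<beta> c x) (j # js)) vs)"
      unfolding sum_distrib_left prod.lessThan_Suc_shift
      by (simp add: interior_right_def interior_form_def mult.assoc)
    \<comment> \<open>The sums are reordered so that each head stands next to its own tail.\<close>
    also have "\<dots> = (\<Sum>i\<in>B. \<Sum>is\<in>?L n. \<Sum>j\<in>B. \<Sum>js\<in>?L n.
      (\<Prod>k<Suc n. w c x [coframe ((i # is) ! k), coframe ((j # js) ! k)]) *
      wedge (foldl (\<lambda>f i. f \<stileturn> i) (\<alpha> c x) (i # is)) (foldl (\<lambda>f j. j \<turnstile> f) (\<beta> c x) (j # js)) vs)"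
      by (intro sum.cong refl sum.swap)
    finally show ?case unfolding lists_Suc by (rule sym)
  qed
  then show "quantum_term B w n \<alpha> \<beta> c x vs = scale_form (1 / fact n) (contracted_wedge n \<alpha> \<beta>) c x vs"
    by (simp add: quantum_term_def scale_form_def)
qed

section \<open>Bilinearity, differentiability and skewness of the coefficients\<close>

lemma contracted_wedge_add_left:
  "contracted_wedge n (\<alpha> + \<alpha>') \<beta> = contracted_wedge n \<alpha> \<beta> + contracted_wedge n \<alpha>' \<beta>"
proof (induction n arbitrary: \<alpha> \<alpha>' \<beta>)
  case (Suc n)
  show ?case
    unfolding contracted_wedge.simps interior_right_add Suc.IH
    by (intro form_ext) (simp add: distrib_left sum.distrib)
qed (simp add: wedge_form_add_left)

lemma contracted_wedge_add_right:
  "contracted_wedge n \<alpha> (\<beta> + \<beta>') = contracted_wedge n \<alpha> \<beta> + contracted_wedge n \<alpha> \<beta>'"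
proof (induction n arbitrary: \<alpha> \<beta> \<beta>')
  case (Suc n)
  show ?case
    unfolding contracted_wedge.simps interior_add Suc.IH
    by (intro form_ext) (simp add: distrib_left sum.distrib)
qed (simp add: wedge_form_add_right)

lemma contracted_wedge_scale_left:
  "contracted_wedge n (scale_form r \<alpha>) \<beta> = scale_form r (contracted_wedge n \<alpha> \<beta>)"
proof (induction n arbitrary: \<alpha> \<beta>)
  case (Suc n)
  show ?case
    unfolding contracted_wedge.simps interior_right_scale Suc.IH
    unfolding scale_form_def sum_distrib_left
    by (intro form_ext) (simp only: scale_form_def sum_distrib_left mult.left_commute)
qed (simp add: wedge_form_scale_left)

lemma contracted_wedge_diff_left:
  "contracted_wedge n (\<alpha> - \<alpha>') \<beta> = contracted_wedge n \<alpha> \<beta> - contracted_wedge n \<alpha>' \<beta>"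
  using contracted_wedge_add_left[of n "\<alpha> - \<alpha>'" \<alpha>' \<beta>] by simp

lemma contracted_wedge_diff_right:
  "contracted_wedge n \<alpha> (\<beta> - \<beta>') = contracted_wedge n \<alpha> \<beta> - contracted_wedge n \<alpha> \<beta>'"
  using contracted_wedge_add_right[of n \<alpha> "\<beta> - \<beta>'" \<beta>'] by simp

lemma differentiable_form_contracted_wedge [intro]:
  "differentiable_form \<alpha> \<Longrightarrow> differentiable_form \<beta> \<Longrightarrow> differentiable_form (contracted_wedge n \<alpha> \<beta>)"
proof (induction n arbitrary: \<alpha> \<beta>)
  case (Suc n)
  have *: "differentiable_form (contracted_wedge n (interior_right i \<alpha>) (interior_form j \<beta>))" for i j
    by (intro Suc.IH differentiable_form_interior_right differentiable_form_interior Suc.prems)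
  show ?case
    unfolding differentiable_form_def
  proof (intro allI impI)
    fix c :: "('a, 'e) chart" and x vs assume "x \<in> image_of c"
    then show "(\<lambda>y. contracted_wedge (Suc n) \<alpha> \<beta> c y vs) differentiable at x"
      unfolding contracted_wedge.simps
      by (intro differentiable_sum ballI finite_B differentiable_mult w_differentiable
          differentiable_formD[OF *])
  qed
qed auto

lemma skew_form_contracted_wedge [intro]:
  "skew_form \<alpha> \<Longrightarrow> skew_form \<beta> \<Longrightarrow> skew_form (contracted_wedge n \<alpha> \<beta>)"
proof (induction n arbitrary: \<alpha> \<beta>)
  case (Suc n)
  have *: "skew_form (contracted_wedge n (interior_right i \<alpha>) (interior_form j \<beta>))" for i j
    by (intro Suc.IH skew_form_interior_right skew_form_interior Suc.prems)
  show ?case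
    unfolding skew_form_def contracted_wedge.simps
    by (intro allI skewI, subst skewD[OF skew_formD[OF *]]) (simp add: sum_negf)
qed auto

text \<open>W is a second order operator, and its failure to be a derivation consists of the mixed
  terms of \<open>wedge_Cons2\<close>. These two sums coincide up to sign because w is skew, so with
  the factor 1 / 2 they add up to a single -C_1.\<close>

lemma w_contract_wedge:
  assumes "skew_form \<alpha>"
  shows "W (wedge_form \<alpha> \<beta>) = wedge_form (W \<alpha>) \<beta> + wedge_form \<alpha> (W \<beta>) - contracted_wedge 1 \<alpha> \<beta>"
proof (rule form_ext)
  fix c x vs
  let ?m = "\<lambda>i j. w c x [coframe i, coframe j]" and ?f = "\<alpha> c x" and ?g = "\<beta> c x"
  have Wfun: "W \<gamma> c x = (\<lambda>us. 1 / 2 * (\<Sum>i\<in>B. \<Sum>j\<in>B. ?m i j * (i \<turnstile> (j \<turnstile> \<gamma> c x)) us))" for \<gamma>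
    by (rule ext) (simp add: w_contract_def)
  have left: "wedge_form (W \<alpha>) \<beta> c x vs =
      1 / 2 * (\<Sum>i\<in>B. \<Sum>j\<in>B. ?m i j * wedge (i \<turnstile> (j \<turnstile> ?f)) ?g vs)"
    unfolding wedge_form_def Wfun wedge_scale_left wedge_sum_left ..
  have right: "wedge_form \<alpha> (W \<beta>) c x vs =
      1 / 2 * (\<Sum>i\<in>B. \<Sum>j\<in>B. ?m i j * wedge ?f (i \<turnstile> (j \<turnstile> ?g)) vs)"
    unfolding wedge_form_def Wfun wedge_scale_right wedge_sum_right ..
  have mixed: "contracted_wedge 1 \<alpha> \<beta> c x vs =
      (\<Sum>i\<in>B. \<Sum>j\<in>B. ?m i j * wedge (invol (i \<turnstile> ?f)) (j \<turnstile> ?g) vs)"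
    using skew_formD[OF assms]
    by (simp add: wedge_form_def interior_right_def interior_form_def skew_right_contract)
  have swapped: "(\<Sum>i\<in>B. \<Sum>j\<in>B. ?m i j * wedge (invol (j \<turnstile> ?f)) (i \<turnstile> ?g) vs) =
      - contracted_wedge 1 \<alpha> \<beta> c x vs"
    unfolding mixed by (subst sum.swap, subst w_skew) (simp add: sum_negf)
  have "W (wedge_form \<alpha> \<beta>) c x vs = 1 / 2 * (\<Sum>i\<in>B. \<Sum>j\<in>B. ?m i j * wedge ?f ?g (j # i # vs))"
    by (simp add: w_contract_apply wedge_form_def)
  also have "(\<Sum>i\<in>B. \<Sum>j\<in>B. ?m i j * wedge ?f ?g (j # i # vs)) =
      (\<Sum>i\<in>B. \<Sum>j\<in>B. ?m i j * wedge (i \<turnstile> (j \<turnstile> ?f)) ?g vs)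
      + (\<Sum>i\<in>B. \<Sum>j\<in>B. ?m i j * wedge (invol (j \<turnstile> ?f)) (i \<turnstile> ?g) vs)
      - (\<Sum>i\<in>B. \<Sum>j\<in>B. ?m i j * wedge (invol (i \<turnstile> ?f)) (j \<turnstile> ?g) vs)
      + (\<Sum>i\<in>B. \<Sum>j\<in>B. ?m i j * wedge ?f (i \<turnstile> (j \<turnstile> ?g)) vs)"
    by (simp add: wedge_Cons2 algebra_simps sum.distrib sum_subtractf)
  finally show "W (wedge_form \<alpha> \<beta>) c x vs =
      (wedge_form (W \<alpha>) \<beta> + wedge_form \<alpha> (W \<beta>) - contracted_wedge 1 \<alpha> \<beta>) c x vs"
    unfolding swapped mixed[symmetric] plus_fun_apply minus_apply left right by (simp add: algebra_simps)
qed

text \<open>The case n = 0 is \<open>w_contract_wedge\<close>. It propagates because W commutes with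
  the contractions that the recursion applies to both factors.\<close>

lemma contracted_wedge_Suc:
  assumes "skew_form \<alpha>" "skew_form \<beta>"
  shows "contracted_wedge (Suc n) \<alpha> \<beta> =
    contracted_wedge n (W \<alpha>) \<beta> + contracted_wedge n \<alpha> (W \<beta>) - W (contracted_wedge n \<alpha> \<beta>)"
  using assms
proof (induction n arbitrary: \<alpha> \<beta>)
  case 0
  then show ?case using w_contract_wedge[of \<alpha> \<beta>] by (simp del: contracted_wedge.simps(2) add: contracted_wedge.simps(1))
next
  case (Suc n)
  show ?case
  proof (rule form_ext)
    fix c x vs
    let ?m = "\<lambda>i j. w c x [coframe i, coframe j]"
    let ?C = "\<lambda>i j. contracted_wedge n (interior_right i \<alpha>) (interior_form j \<beta>)"
    \<comment> \<open>W fills the first two arguments and the right contraction the last one, so no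
      sign can occur.\<close>
    have W_right: "W (interior_right i \<alpha>) = interior_right i (W \<alpha>)" for i
      by (intro form_ext) (simp add: w_contract_apply)
    have "contracted_wedge (Suc n) (interior_right i \<alpha>) (interior_form j \<beta>) =
        contracted_wedge n (interior_right i (W \<alpha>)) (interior_form j \<beta>)
        + contracted_wedge n (interior_right i \<alpha>) (interior_form j (W \<beta>)) - W (?C i j)" for i j
      using Suc.IH[OF skew_form_interior_right[OF Suc.prems(1)] skew_form_interior[OF Suc.prems(2)]]
      unfolding W_right w_contract_interior[OF Suc.prems(2)] .
    then have "contracted_wedge (Suc (Suc n)) \<alpha> \<beta> c x vs =
        contracted_wedge (Suc n) (W \<alpha>) \<beta> c x vs + contracted_wedge (Suc n) \<alpha> (W \<beta>) c x vs
        - (\<Sum>i\<in>B. \<Sum>j\<in>B. ?m i j * W (?C i j) c x vs)"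
      by (subst contracted_wedge.simps(2))
        (simp add: distrib_left right_diff_distrib sum.distrib sum_subtractf)
    \<comment> \<open>W acts pointwise, so the coefficients of the outer contraction pass through
      it.\<close>
    also have "(\<Sum>i\<in>B. \<Sum>j\<in>B. ?m i j * W (?C i j) c x vs) = W (contracted_wedge (Suc n) \<alpha> \<beta>) c x vs"
      unfolding w_contract_apply contracted_wedge.simps sum_distrib_left
      by (subst sum_exchange_pairs) (simp only: mult.left_commute)
    finally show "contracted_wedge (Suc (Suc n)) \<alpha> \<beta> c x vs = (contracted_wedge (Suc n) (W \<alpha>) \<beta>
        + contracted_wedge (Suc n) \<alpha> (W \<beta>) - W (contracted_wedge (Suc n) \<alpha> \<beta>)) c x vs"
      by (simp only: plus_fun_apply minus_apply)
  qed
qed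

text \<open>The factor n makes the truncated \<open>n - 1\<close> harmless at n = 0.\<close>

lemma scale_contracted_wedge:
  assumes "skew_form \<alpha>" "skew_form \<beta>"
  shows "scale_form (real n) (contracted_wedge n \<alpha> \<beta>) =
    scale_form (real n) (contracted_wedge (n - 1) (W \<alpha>) \<beta> + contracted_wedge (n - 1) \<alpha> (W \<beta>)
      - W (contracted_wedge (n - 1) \<alpha> \<beta>))"
  by (cases n) (simp_all add: contracted_wedge_Suc[OF assms] del: contracted_wedge.simps)

text \<open>This is n! times the coefficient of h^n in the Leibniz rule for d_h; the factor n is n!
  / (n - 1)!.\<close>

lemma ext_d_contracted_wedge:
  assumes "skew_form \<alpha>" "differentiable_form \<alpha>" "skew_form \<beta>" "differentiable_form \<beta>"
  shows "ext_d (contracted_wedge n \<alpha> \<beta>) =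
    contracted_wedge n (ext_d \<alpha>) \<beta> + contracted_wedge n (grade \<alpha>) (ext_d \<beta>)
    + scale_form (real n) (\<delta> (contracted_wedge (n - 1) \<alpha> \<beta>)
      - contracted_wedge (n - 1) (\<delta> \<alpha>) \<beta> - contracted_wedge (n - 1) (grade \<alpha>) (\<delta> \<beta>))"
  using assms
proof (induction n arbitrary: \<alpha> \<beta>)
  case 0
  then show ?case by (simp add: ext_d_wedge)
next
  case (Suc n)
  note a = Suc.prems(1,2) and b = Suc.prems(3,4)
  note s = a(1) b(1) skew_form_ext_d[OF a] skew_form_ext_d[OF b] skew_form_koszul[OF a]
    skew_form_koszul[OF b] skew_form_grade[OF a(1)]
  note wa = skew_form_w_contract[OF a(1)] differentiable_form_w_contract[OF a(2)]
  note wb = skew_form_w_contract[OF b(1)] differentiable_form_w_contract[OF b(2)]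
  let ?C = "contracted_wedge n" and ?C' = "contracted_wedge (n - 1)"
  let ?n = "scale_form (real n)"
  have d_W: "ext_d (W \<gamma>) = W (ext_d \<gamma>) - \<delta> \<gamma>" for \<gamma>
    by (simp add: koszul_def)
  note dC = differentiable_form_contracted_wedge
  \<comment> \<open>The recursion for n C_n is applied inside \<delta>, and \<delta> is moved past W
    by \<open>koszul_w_contract\<close>. This lowers the index to n - 1, where the induction
    hypotheses have their \<delta> terms.\<close>
  have nC: "?n (\<delta> (?C \<alpha> \<beta>)) =
      ?n (\<delta> (?C' (W \<alpha>) \<beta>)) + ?n (\<delta> (?C' \<alpha> (W \<beta>))) - ?n (W (\<delta> (?C' \<alpha> \<beta>)))"
  proof -
    have "?n (\<delta> (?C \<alpha> \<beta>)) = \<delta> (?n (?C \<alpha> \<beta>))"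
      by (rule koszul_scale[symmetric]) (intro dC a b)
    also have "\<dots> = ?n (\<delta> (?C' (W \<alpha>) \<beta> + ?C' \<alpha> (W \<beta>) - W (?C' \<alpha> \<beta>)))"
      unfolding scale_contracted_wedge[OF a(1) b(1)]
      by (rule koszul_scale) (intro differentiable_form_add differentiable_form_diff
          differentiable_form_w_contract dC a b wa wb)
    also have "\<delta> (?C' (W \<alpha>) \<beta> + ?C' \<alpha> (W \<beta>) - W (?C' \<alpha> \<beta>)) =
        \<delta> (?C' (W \<alpha>) \<beta>) + \<delta> (?C' \<alpha> (W \<beta>)) - W (\<delta> (?C' \<alpha> \<beta>))"
      by (subst koszul_diff koszul_add koszul_w_contract; (intro differentiable_form_add
          differentiable_form_w_contract skew_form_contracted_wedge dC a b wa wb)?)+ (rule refl)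
    finally show ?thesis by (simp only: scale_form_add scale_form_diff)
  qed
  \<comment> \<open>Moving d past W in the last term of the recursion leaves an extra \<delta> C_n,
    which raises the factor n to n + 1. The same happens inside the arguments W \<alpha> and W
    \<beta> and yields the extra terms with \<delta> \<alpha> and \<delta> \<beta>.\<close>
  have "ext_d (contracted_wedge (Suc n) \<alpha> \<beta>) =
      ext_d (?C (W \<alpha>) \<beta>) + ext_d (?C \<alpha> (W \<beta>)) - W (ext_d (?C \<alpha> \<beta>)) + \<delta> (?C \<alpha> \<beta>)"
    unfolding contracted_wedge_Suc[OF a(1) b(1)]
    by (simp add: ext_d_add ext_d_diff differentiable_form_add differentiable_form_w_contract dC a b wa wb d_W)
  note expanded = this[unfolded Suc.IH[OF a b] Suc.IH[OF wa b] Suc.IH[OF a wb] d_W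
      koszul_w_contract[OF a] koszul_w_contract[OF b] w_contract_add w_contract_diff w_contract_scale
      contracted_wedge_diff_left contracted_wedge_diff_right scale_form_add scale_form_diff
      w_contract_grade[symmetric]]
  \<comment> \<open>Once the index n + 1, and every index n carrying the factor n, is lowered by the
    recursion, both sides are linear combinations of the same values.\<close>
  have "contracted_wedge (Suc n) (ext_d \<alpha>) \<beta> + contracted_wedge (Suc n) (grade \<alpha>) (ext_d \<beta>)
    + scale_form (real (Suc n)) (\<delta> (?C \<alpha> \<beta>) - ?C (\<delta> \<alpha>) \<beta> - ?C (grade \<alpha>) (\<delta> \<beta>))
    = ext_d (contracted_wedge (Suc n) \<alpha> \<beta>)"
    unfolding contracted_wedge_Suc[OF s(3,2)] contracted_wedge_Suc[OF s(7,4)] diff_Suc_1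
      scale_form_Suc scale_form_diff nC scale_contracted_wedge[OF s(5,2)]
      scale_contracted_wedge[OF s(7,6)] scale_form_add
  proof (rule form_ext, unfold plus_fun_apply minus_apply, goal_cases)
    case (1 c x vs)
    show ?case
      using fun_cong[OF fun_cong[OF fun_cong[OF expanded]], of c x vs, unfolded plus_fun_apply minus_apply]
      by linarith
  qed
  from this[symmetric] show ?case by (simp only: diff_Suc_1)
qed

text \<open>Integer index with value 0 below zero, so that shifts by powers of h need no truncated
  subtraction.\<close>

definition quantum_coeff :: "int \<Rightarrow> ('a, 'e) form \<Rightarrow> ('a, 'e) form \<Rightarrow> ('a, 'e) form" where
  "quantum_coeff n \<alpha> \<beta> = (if 0 \<le> n then quantum_term B w (nat n) \<alpha> \<beta> else 0)"

lemma quantum_coeff_diff_left: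
  "quantum_coeff n (\<alpha> - \<alpha>') \<beta> = quantum_coeff n \<alpha> \<beta> - quantum_coeff n \<alpha>' \<beta>"
  by (simp add: quantum_coeff_def quantum_term_contracted_wedge contracted_wedge_diff_left scale_form_diff)

lemma quantum_coeff_diff_right:
  "quantum_coeff n \<alpha> (\<beta> - \<beta>') = quantum_coeff n \<alpha> \<beta> - quantum_coeff n \<alpha> \<beta>'"
  by (simp add: quantum_coeff_def quantum_term_contracted_wedge contracted_wedge_diff_right scale_form_diff)

lemma quantum_coeff_zero [simp]: "quantum_coeff n 0 \<beta> = 0" "quantum_coeff n \<alpha> 0 = 0"
  using quantum_coeff_diff_left[of n 0 0] quantum_coeff_diff_right[of n \<alpha> 0 0] by simp_all

lemma quantum_coeff_scale_left:
  "quantum_coeff n (scale_form r \<alpha>) \<beta> = scale_form r (quantum_coeff n \<alpha> \<beta>)"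
  by (simp add: quantum_coeff_def quantum_term_contracted_wedge contracted_wedge_scale_left
      scale_form_scale mult.commute)

lemma differentiable_form_quantum_coeff [intro]:
  "differentiable_form \<alpha> \<Longrightarrow> differentiable_form \<beta> \<Longrightarrow> differentiable_form (quantum_coeff n \<alpha> \<beta>)"
  by (auto simp: quantum_coeff_def quantum_term_contracted_wedge)

lemma quantum_coeff_derivation:
  assumes "skew_form \<alpha>" "differentiable_form \<alpha>" "skew_form \<beta>" "differentiable_form \<beta>"
  shows "ext_d (quantum_coeff n \<alpha> \<beta>) - \<delta> (quantum_coeff (n - 1) \<alpha> \<beta>) =
    quantum_coeff n (ext_d \<alpha>) \<beta> - quantum_coeff (n - 1) (\<delta> \<alpha>) \<beta>
    + (quantum_coeff n (grade \<alpha>) (ext_d \<beta>) - quantum_coeff (n - 1) (grade \<alpha>) (\<delta> \<beta>))"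
proof (cases n)
  case (nonneg m)
  note dC = differentiable_form_contracted_wedge[OF assms(2,4)]
  show ?thesis
  proof (cases m)
    \<comment> \<open>Here n - 1 = -1, so all \<delta> terms vanish by the convention for negative
      indices, and on the other side by the factor 0.\<close>
    case 0
    then show ?thesis
      using nonneg ext_d_contracted_wedge[OF assms, of 0]
      by (simp add: quantum_coeff_def quantum_term_contracted_wedge ext_d_scale dC scale_form_add
          del: contracted_wedge.simps)
  next
    case (Suc l)
    \<comment> \<open>Turns the factor n into the normalisation of the coefficient of
      h^(n-1).\<close>
    have fact: "1 / fact (Suc l) * real (Suc l) = 1 / fact l"
      by (simp add: fact_Suc del: of_nat_Suc)
    have [simp]: "nat (1 + int l) = Suc l" by simp
    have "ext_d (quantum_coeff n \<alpha> \<beta>) = scale_form (1 / fact (Suc l)) (ext_d (contracted_wedge (Suc l) \<alpha> \<beta>))"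
      using nonneg Suc
      by (simp add: quantum_coeff_def quantum_term_contracted_wedge ext_d_scale dC
          del: contracted_wedge.simps fact_Suc)
    also have "\<dots> = quantum_coeff n (ext_d \<alpha>) \<beta> + quantum_coeff n (grade \<alpha>) (ext_d \<beta>) +
        (\<delta> (quantum_coeff (n - 1) \<alpha> \<beta>) - quantum_coeff (n - 1) (\<delta> \<alpha>) \<beta>
         - quantum_coeff (n - 1) (grade \<alpha>) (\<delta> \<beta>))"
      unfolding ext_d_contracted_wedge[OF assms] scale_form_add scale_form_scale fact
      using nonneg Suc
      by (simp add: quantum_coeff_def quantum_term_contracted_wedge koszul_scale dC scale_form_diff
          del: contracted_wedge.simps fact_Suc)
    finally show ?thesis by (simp add: algebra_simps)
  qed
next
  case (neg m)
  then show ?thesis by (simp add: quantum_coeff_def)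
qed

text \<open>The index sets may exceed the supports: the support of d_h \<alpha> is known only up to
  an upper bound, since terms may cancel.\<close>

lemma quantum_wedge_eq:
  assumes "finite S" "h_support \<alpha> \<subseteq> S" "finite R" "h_support \<beta> \<subseteq> R"
  shows "quantum_wedge B w \<alpha> \<beta> m = (\<Sum>a\<in>S. \<Sum>b\<in>R. quantum_coeff (m - a - b) (\<alpha> a) (\<beta> b))"
proof -
  have "quantum_wedge B w \<alpha> \<beta> m =
      (\<Sum>a\<in>h_support \<alpha>. \<Sum>b\<in>h_support \<beta>. quantum_coeff (m - a - b) (\<alpha> a) (\<beta> b))"
    unfolding quantum_wedge_def by (intro sum.cong refl) (simp add: quantum_coeff_def algebra_simps)
  also have "\<dots> = (\<Sum>a\<in>h_support \<alpha>. \<Sum>b\<in>R. quantum_coeff (m - a - b) (\<alpha> a) (\<beta> b))"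
    by (intro sum.cong refl sum.mono_neutral_left assms) (auto simp: h_support_def)
  also have "\<dots> = (\<Sum>a\<in>S. \<Sum>b\<in>R. quantum_coeff (m - a - b) (\<alpha> a) (\<beta> b))"
    by (intro sum.mono_neutral_left assms) (auto simp: h_support_def)
  finally show ?thesis .
qed

text \<open>Reindexing for multiplication by h, which moves coefficients from S to S + 1.\<close>

lemma sum_shift_support:
  fixes h :: "int \<Rightarrow> 'm::comm_monoid_add"
  assumes "finite S'" "S \<union> (\<lambda>a. a + 1) ` S \<subseteq> S'" "\<And>a. a \<notin> S \<Longrightarrow> h a = 0"
  shows "(\<Sum>a\<in>S'. h (a - 1)) = (\<Sum>a\<in>S. h a)"
proof -
  have "(\<Sum>a\<in>S'. h (a - 1)) = (\<Sum>a\<in>(\<lambda>a. a - 1) ` S'. h a)"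
    by (subst sum.reindex) (auto simp: inj_on_def)
  also have "\<dots> = (\<Sum>a\<in>S. h a)"
  proof (rule sum.mono_neutral_right)
    show "S \<subseteq> (\<lambda>a. a - 1) ` S'"
    proof
      fix a assume "a \<in> S"
      then have "a + 1 \<in> S'" using assms(2) by blast
      then show "a \<in> (\<lambda>a. a - 1) ` S'" by (rule image_eqI[rotated]) simp
    qed
  qed (use assms in auto)
  finally show ?thesis .
qed

text \<open>The coefficientwise rule \<open>quantum_coeff_derivation\<close> is summed over both
  supports; r is the scalar by which \<open>grade\<close> acts on all coefficients of
  \<alpha>.\<close>

lemma quantum_d_quantum_wedge:
  assumes fin: "finite (h_support \<alpha>)" "finite (h_support \<beta>)"
    and \<alpha>: "\<And>n. skew_form (\<alpha> n)" "\<And>n. differentiable_form (\<alpha> n)"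
    and \<beta>: "\<And>n. skew_form (\<beta> n)" "\<And>n. differentiable_form (\<beta> n)"
    and grade: "\<And>n. grade (\<alpha> n) = scale_form r (\<alpha> n)"
  shows "quantum_d B w (quantum_wedge B w \<alpha> \<beta>) =
    quantum_wedge B w (quantum_d B w \<alpha>) \<beta> + h_scale r (quantum_wedge B w \<alpha> (quantum_d B w \<beta>))"
proof (rule ext)
  fix m
  \<comment> \<open>The coefficient of h^m in d_h \<alpha> involves those of h^m and h^(m-1) in
    \<alpha>, hence the shifted copy.\<close>
  define S S' where "S = h_support \<alpha>" and "S' = S \<union> (\<lambda>a. a + 1) ` S"
  define R R' where "R = h_support \<beta>" and "R' = R \<union> (\<lambda>a. a + 1) ` R"
  let ?q = "\<lambda>n a b. quantum_coeff (n - a - b)"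
  have finite: "finite S" "finite S'" "finite R" "finite R'"
    using fin by (auto simp: S_def S'_def R_def R'_def)
  have zero: "\<alpha> a = 0" if "a \<notin> S" for a using that by (simp add: S_def h_support_def)
  have zero': "\<beta> a = 0" if "a \<notin> R" for a using that by (simp add: R_def h_support_def)
  have vanish: "quantum_coeff n (ext_d (\<alpha> a)) \<gamma> = 0" "quantum_coeff n (\<delta> (\<alpha> a)) \<gamma> = 0"
    if "a \<notin> S" for n a \<gamma>
    unfolding zero[OF that] ext_d_zero koszul_zero quantum_coeff_zero by (rule refl)+
  have vanish': "quantum_coeff n \<gamma> (ext_d (\<beta> b)) = 0" "quantum_coeff n \<gamma> (\<delta> (\<beta> b)) = 0"
    if "b \<notin> R" for n b \<gamma>
    unfolding zero'[OF that] ext_d_zero koszul_zero quantum_coeff_zero by (rule refl)+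
  have support_d: "h_support (quantum_d B w \<alpha>) \<subseteq> S'" "h_support (quantum_d B w \<beta>) \<subseteq> R'"
  proof -
    show "h_support (quantum_d B w \<alpha>) \<subseteq> S'"
    proof
      fix a assume "a \<in> h_support (quantum_d B w \<alpha>)"
      then have "a \<in> S \<or> a - 1 \<in> S"
        using zero by (auto simp: h_support_def[of "quantum_d _ _ _"] quantum_d_def)
      then show "a \<in> S'" by (force simp: S'_def)
    qed
    show "h_support (quantum_d B w \<beta>) \<subseteq> R'"
    proof
      fix a assume "a \<in> h_support (quantum_d B w \<beta>)"
      then have "a \<in> R \<or> a - 1 \<in> R"
        using zero' by (auto simp: h_support_def[of "quantum_d _ _ _"] quantum_d_def)
      then show "a \<in> R'" by (force simp: R'_def)
    qed
  qed
  have wedge: "quantum_wedge B w \<alpha> \<beta> n = (\<Sum>a\<in>S. \<Sum>b\<in>R. ?q n a b (\<alpha> a) (\<beta> b))" for n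
    by (rule quantum_wedge_eq) (auto simp: finite S_def R_def fin)
  have "quantum_d B w (quantum_wedge B w \<alpha> \<beta>) m =
      (\<Sum>a\<in>S. \<Sum>b\<in>R. ext_d (?q m a b (\<alpha> a) (\<beta> b)) - \<delta> (quantum_coeff (m - a - b - 1) (\<alpha> a) (\<beta> b)))"
    unfolding quantum_d_def wedge
    by (simp add: ext_d_sum koszul_sum differentiable_form_sum differentiable_form_quantum_coeff \<alpha> \<beta>
        sum_subtractf algebra_simps)
  also have "\<dots> = (\<Sum>a\<in>S. \<Sum>b\<in>R. ?q m a b (ext_d (\<alpha> a)) (\<beta> b) - ?q (m - 1) a b (\<delta> (\<alpha> a)) (\<beta> b))
      + (\<Sum>a\<in>S. \<Sum>b\<in>R. ?q m a b (grade (\<alpha> a)) (ext_d (\<beta> b)) - ?q (m - 1) a b (grade (\<alpha> a)) (\<delta> (\<beta> b)))"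
  proof -
    have "ext_d (?q m a b (\<alpha> a) (\<beta> b)) - \<delta> (quantum_coeff (m - a - b - 1) (\<alpha> a) (\<beta> b)) =
        ?q m a b (ext_d (\<alpha> a)) (\<beta> b) - ?q (m - 1) a b (\<delta> (\<alpha> a)) (\<beta> b)
        + (?q m a b (grade (\<alpha> a)) (ext_d (\<beta> b)) - ?q (m - 1) a b (grade (\<alpha> a)) (\<delta> (\<beta> b)))"
      for a b
    proof -
      have "m - 1 - a - b = m - a - b - 1" by simp
      then show ?thesis
        using quantum_coeff_derivation[OF \<alpha> \<beta>, of "m - a - b" a b] by (simp only:)
    qed
    then show ?thesis by (simp only: sum.distrib)
  qed
  also have "(\<Sum>a\<in>S. \<Sum>b\<in>R. ?q m a b (ext_d (\<alpha> a)) (\<beta> b) - ?q (m - 1) a b (\<delta> (\<alpha> a)) (\<beta> b)) =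
      quantum_wedge B w (quantum_d B w \<alpha>) \<beta> m"
  proof -
    have "quantum_wedge B w (quantum_d B w \<alpha>) \<beta> m =
        (\<Sum>a\<in>S'. \<Sum>b\<in>R. ?q m a b (ext_d (\<alpha> a) - \<delta> (\<alpha> (a - 1))) (\<beta> b))"
      using quantum_wedge_eq[OF finite(2) support_d(1) finite(3), of \<beta> m]
      by (simp add: R_def quantum_d_def)
    \<comment> \<open>The index m - a - b of the \<delta> part is rewritten as (m - 1) - (a - 1) -
      b, ready for the shift of a.\<close>
    also have "\<dots> = (\<Sum>a\<in>S'. \<Sum>b\<in>R. ?q m a b (ext_d (\<alpha> a)) (\<beta> b))
        - (\<Sum>a\<in>S'. \<Sum>b\<in>R. ?q (m - 1) (a - 1) b (\<delta> (\<alpha> (a - 1))) (\<beta> b))"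
      by (simp add: quantum_coeff_diff_left sum_subtractf)
    also have "(\<Sum>a\<in>S'. \<Sum>b\<in>R. ?q (m - 1) (a - 1) b (\<delta> (\<alpha> (a - 1))) (\<beta> b)) =
        (\<Sum>a\<in>S. \<Sum>b\<in>R. ?q (m - 1) a b (\<delta> (\<alpha> a)) (\<beta> b))"
      by (rule sum_shift_support[OF finite(2)]) (simp add: S'_def, intro sum.neutral ballI vanish)
    also have "(\<Sum>a\<in>S'. \<Sum>b\<in>R. ?q m a b (ext_d (\<alpha> a)) (\<beta> b)) =
        (\<Sum>a\<in>S. \<Sum>b\<in>R. ?q m a b (ext_d (\<alpha> a)) (\<beta> b))"
      by (rule sum.mono_neutral_right[OF finite(2)]) (auto simp: S'_def vanish)
    finally show ?thesis by (simp only: sum_subtractf)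
  qed
  also have "(\<Sum>a\<in>S. \<Sum>b\<in>R. ?q m a b (grade (\<alpha> a)) (ext_d (\<beta> b)) - ?q (m - 1) a b (grade (\<alpha> a)) (\<delta> (\<beta> b))) =
      scale_form r (quantum_wedge B w \<alpha> (quantum_d B w \<beta>) m)"
  proof -
    have scale_sum: "scale_form r (\<Sum>i\<in>I. f i) = (\<Sum>i\<in>I. scale_form r (f i))"
      for I :: "int set" and f :: "int \<Rightarrow> ('a, 'e) form"
      using sum_comp_morphism[of "scale_form r", OF scale_form_zero(2) scale_form_add, of f I]
      by (simp only: comp_def)
    have "quantum_wedge B w \<alpha> (quantum_d B w \<beta>) m =
        (\<Sum>a\<in>S. \<Sum>b\<in>R'. ?q m a b (\<alpha> a) (ext_d (\<beta> b) - \<delta> (\<beta> (b - 1))))"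
      using quantum_wedge_eq[OF finite(1) _ finite(4) support_d(2), of \<alpha> m]
      by (simp add: S_def quantum_d_def)
    also have "\<dots> = (\<Sum>a\<in>S. (\<Sum>b\<in>R'. ?q m a b (\<alpha> a) (ext_d (\<beta> b)))
        - (\<Sum>b\<in>R'. ?q (m - 1) a (b - 1) (\<alpha> a) (\<delta> (\<beta> (b - 1)))))"
    proof -
      have "m - 1 - a - (b - 1) = m - a - b" for a b by simp
      then show ?thesis by (simp only: quantum_coeff_diff_right sum_subtractf)
    qed
    also have "\<dots> = (\<Sum>a\<in>S. (\<Sum>b\<in>R. ?q m a b (\<alpha> a) (ext_d (\<beta> b)))
        - (\<Sum>b\<in>R. ?q (m - 1) a b (\<alpha> a) (\<delta> (\<beta> b))))"
    proof (rule sum.cong[OF refl], rule arg_cong2[of _ _ _ _ minus])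
      fix a
      show "(\<Sum>b\<in>R'. ?q m a b (\<alpha> a) (ext_d (\<beta> b))) = (\<Sum>b\<in>R. ?q m a b (\<alpha> a) (ext_d (\<beta> b)))"
        by (rule sum.mono_neutral_right[OF finite(4)]) (auto simp: R'_def vanish')
      show "(\<Sum>b\<in>R'. ?q (m - 1) a (b - 1) (\<alpha> a) (\<delta> (\<beta> (b - 1)))) =
          (\<Sum>b\<in>R. ?q (m - 1) a b (\<alpha> a) (\<delta> (\<beta> b)))"
        by (rule sum_shift_support[OF finite(4)]) (simp add: R'_def, intro sum.neutral ballI vanish')
    qed
    finally show ?thesis
      by (simp only: grade quantum_coeff_scale_left scale_sum scale_form_diff sum_subtractf)
  qed
  finally show "quantum_d B w (quantum_wedge B w \<alpha> \<beta>) m =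
      (quantum_wedge B w (quantum_d B w \<alpha>) \<beta> + h_scale r (quantum_wedge B w \<alpha> (quantum_d B w \<beta>))) m"
    by (simp add: fun_eq_iff h_scale_def scale_form_def)
qed

end

section \<open>From a Poisson manifold to the chart-wise hypotheses\<close>

lemma smooth_on_differentiable: "smooth_on S f \<Longrightarrow> x \<in> S \<Longrightarrow> f differentiable (at x)"
  unfolding smooth_on_def by (metis times_differentiable_on.simps(2))

lemma forms_skew:
  assumes "\<omega> \<in> forms A"
  shows "skew_form \<omega>"
  unfolding skew_form_def
proof (intro allI)
  fix c x
  show "skew (\<omega> c x)"
  proof (cases "c \<in> A \<and> x \<in> image_of c")
    case True
    then show ?thesis
      using assms alternating_multilinear_skew unfolding forms_def by blast
  next
    case False
    then have "\<omega> c x = 0" using assms unfolding forms_def by blast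
    then show ?thesis by (simp add: skew_def)
  qed
qed

lemma forms_differentiable:
  assumes "\<omega> \<in> forms A"
  shows "differentiable_form \<omega>"
  unfolding differentiable_form_def
proof (intro allI impI)
  fix c :: "('a, 'b) chart" and x vs assume x: "x \<in> image_of c"
  show "(\<lambda>y. \<omega> c y vs) differentiable at x"
  proof (cases "c \<in> A")
    case True
    then have "smooth_on (image_of c) (\<lambda>y. \<omega> c y vs)"
      using assms unfolding forms_def by blast
    then show ?thesis using x by (rule smooth_on_differentiable)
  next
    case False
    then have "\<omega> c y = 0" for y using assms unfolding forms_def by blast
    then show ?thesis by simp
  qed
qed

text \<open>For p = q = 2 the sign in \<open>schouten\<close> is (-1)^9, so the two sums add up to
  twice the expression in \<open>jacobi\<close>.\<close>

lemma poisson_manifold_bivector: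
  fixes w :: "('a, 'e::real_inner) multivector"
  assumes "poisson_manifold B X A w"
  shows "poisson_bivector B w"
proof
  have w: "w \<in> multivector_fields A 2" and bracket: "schouten B 2 2 w w = 0"
    and B: "orthonormal_basis B"
    using assms unfolding poisson_manifold_def smooth_manifold_def by auto
  show "finite B" using B unfolding orthonormal_basis_def by blast
  have outside: "w c x = 0" if "\<not> (c \<in> A \<and> x \<in> image_of c)" for c x
    using w that unfolding multivector_fields_def by blast
  have degree: "w c x \<xi>s = 0" if "length \<xi>s \<noteq> 2" for c x \<xi>s
    using w that unfolding multivector_fields_def by blast
  show "w c x [\<xi>, \<eta>] = - w c x [\<eta>, \<xi>]" for c x \<xi> \<eta>
  proof (cases "c \<in> A \<and> x \<in> image_of c")
    case True
    then have "skew (w c x)"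
      using w alternating_multilinear_skew unfolding multivector_fields_def by blast
    then show ?thesis by (rule skew_Cons)
  next
    case False
    then show ?thesis by (simp add: outside)
  qed
  show "(\<lambda>y. w c y [\<xi>, \<eta>]) differentiable at x" if x: "x \<in> image_of c"
    for c :: "('a, 'e) chart" and x \<xi> \<eta>
  proof (cases "c \<in> A")
    case True
    then have "smooth_on (image_of c) (\<lambda>y. w c y [\<xi>, \<eta>])"
      using w unfolding multivector_fields_def by blast
    then show ?thesis using x by (rule smooth_on_differentiable)
  next
    case False
    then show ?thesis by (simp add: outside)
  qed
  fix c :: "('a, 'e) chart" and x \<xi> \<eta> \<zeta> assume x: "x \<in> image_of c"
  have degree': "partial_multivector b w c x \<xi>s = 0" if "length \<xi>s \<noteq> 2" for b \<xi>s
    using that by (simp add: partial_multivector_def degree)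
  \<comment> \<open>Of the eight splittings of three covectors only those giving one to the first
    factor survive, by degree.\<close>
  have "wedge (w c x \<stileturn> coframe b) (partial_multivector b w c x) [\<xi>, \<eta>, \<zeta>] =
      w c x [\<xi>, coframe b] * partial_multivector b w c x [\<eta>, \<zeta>]
      - w c x [\<eta>, coframe b] * partial_multivector b w c x [\<xi>, \<zeta>]
      + w c x [\<zeta>, coframe b] * partial_multivector b w c x [\<xi>, \<eta>]" for b
    by (simp add: wedge_Cons left_contract_def right_contract_def invol_def degree degree')
  moreover have "schouten B 2 2 w w c x [\<xi>, \<eta>, \<zeta>] = 0"
    using bracket by simp
  ultimately show "(\<Sum>b\<in>B. w c x [\<xi>, coframe b] * partial_multivector b w c x [\<eta>, \<zeta>])
      - (\<Sum>b\<in>B. w c x [\<eta>, coframe b] * partial_multivector b w c x [\<xi>, \<zeta>])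
      + (\<Sum>b\<in>B. w c x [\<zeta>, coframe b] * partial_multivector b w c x [\<xi>, \<eta>]) = 0"
    using x by (simp add: schouten_def sum.distrib sum_subtractf)
qed

lemma grade_has_degree:
  assumes "has_degree \<omega> k"
  shows "grade \<omega> = scale_form ((-1) powi k) \<omega>"
proof (rule form_ext)
  fix c x vs
  show "grade \<omega> c x vs = scale_form ((-1) powi k) \<omega> c x vs"
  proof (cases "int (length vs) = k")
    case True
    then have "(-1) powi k = ((-1) ^ length vs :: real)"
      by (simp flip: True add: power_int_of_nat)
    then show ?thesis by (simp add: grade_apply scale_form_def)
  next
    case False
    then have "\<omega> c x vs = 0" using assms unfolding has_degree_def by blast
    then show ?thesis by (simp add: grade_apply scale_form_def)
  qed
qed

theorem theorem2:
  fixes B :: "'e::real_inner set" and X :: "'a topology" and A :: "('a, 'e) chart set"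
    and w :: "('a, 'e) multivector" and \<alpha> \<beta> :: "('a, 'e) hform" and k :: int
  assumes "poisson_manifold B X A w"
    and "\<alpha> \<in> poly_forms A \<and> \<beta> \<in> poly_forms A \<or> \<alpha> \<in> laurent_forms A \<and> \<beta> \<in> laurent_forms A"
    and "homogeneous \<alpha> k"
  shows "quantum_d B w (quantum_wedge B w \<alpha> \<beta>) =
    quantum_wedge B w (quantum_d B w \<alpha>) \<beta> +
    h_scale ((-1) powi k) (quantum_wedge B w \<alpha> (quantum_d B w \<beta>))"
proof -
  interpret poisson_bivector B w
    using assms(1) by (rule poisson_manifold_bivector)
  have "\<alpha> \<in> laurent_forms A" "\<beta> \<in> laurent_forms A"
    using assms(2) by (auto simp: poly_forms_def)
  then have \<alpha>: "finite (h_support \<alpha>)" "\<And>n. \<alpha> n \<in> forms A"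
    and \<beta>: "finite (h_support \<beta>)" "\<And>n. \<beta> n \<in> forms A"
    by (auto simp: laurent_forms_def)
  have "grade (\<alpha> n) = scale_form ((-1) powi k) (\<alpha> n)" for n
  proof -
    have "grade (\<alpha> n) = scale_form ((-1) powi (k - 2 * n)) (\<alpha> n)"
      using assms(3) unfolding homogeneous_def by (intro grade_has_degree) blast
    \<comment> \<open>As h has even degree, one sign serves all coefficients of \<alpha>.\<close>
    also have "(-1) powi (k - 2 * n) = ((-1) powi k :: real)"
      by (simp add: power_int_diff power_int_mult)
    finally show ?thesis .
  qed
  then show ?thesis
    using \<alpha> \<beta> by (intro quantum_d_quantum_wedge forms_skew forms_differentiable)
qed

end
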